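(* For each $n\ge 1$ let $\mathcal{C}_n=\bigcup_k B(T_n^{(k)},X_n^{(k)}\sqrt n)\subset\mathbb{R}^n$ be the Boolean model built on a homogeneous Poisson point process of intensity $e^{n\rho_n}$ in $\mathbb{R}^n$, with $\rho_n\to\rho\in\mathbb{R}$, and with i.i.d. marks $X_n^{(k)}\stackrel{d}{=}\bar X_n\ge 0$ independent of the points. Assume that $R^*:=\lim_{n\to\infty}\mathbb{E}[\bar X_n]$ exists with $0<R^*<\infty$, that $(\bar X_n)_{n\ge1}$ satisfies a large deviations principle (speed $n$) with good convex rate function $I$, and that $\limsup_{n\to\infty}\mathbb{E}[(\bar X_n)^{\gamma n}]^{1/n}<\infty$ for some $\gamma>1$. Then the volume fraction threshold is equal to $$\tau_v=-\tfrac12\log(2\pi e)+\inf_{R\ge R^*}\bigl(I(R)-\log R\bigr).$$ More precisely, if $\rho<\tau_v$, then as $n\to\infty$ the volume fraction $\mathbb{P}(\underline{0}\in\mathcal{C}_n)$ tends to $0$ exponentially fast, with $$\lim_{n\to\infty}\frac1n\log \mathbb{P}(\underline{0}\in\mathcal{C}_n)=\rho-\tau_v,$$ whereas if $\rho>\tau_v$, then $\mathbb{P}(\underline{0}\in\mathcal{C}_n)$ tends to $1$, with $$\lim_{n\to\infty}\frac1n\log\bigl(-\log\mathbb{P}(\underline{0}\notin\mathcal{C}_n)\bigr)=\rho-\tau_v.$$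
   Context: $\log$ is the natural logarithm. $B(t,r)$ is the closed Euclidean ball of center $t\in\mathbb{R}^n$ and radius $r\ge 0$, and $\underline{0}$ is the origin of $\mathbb{R}^n$. $T_n^{(k)}$, $k\ge1$, is an enumeration of the points of the Poisson process in dimension $n$; $\mathbb{P}$ is the law of the stationary marked process. The coupling between different dimensions is irrelevant. A good rate function is a lower semicontinuous function $I:\mathbb{R}\to[0,\infty]$ with compact sublevel sets. The volume fraction threshold is the number $\tau_v$ such that $\mathbb{P}(\underline{0}\in\mathcal{C}_n)\to 0$ for $\rho<\tau_v$ and $\mathbb{P}(\underline{0}\in\mathcal{C}_n)\to1$ for $\rho>\tau_v$. Under the assumptions, $I(R^* )=0$. *)

theory Defs
  imports "HOL-Probability.Probability"
begin

section \<open>Extended-valued functions\<close>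

(* Avoids the HOL convention ln 0 = 0: here the logarithm of 0 is -\<infinity>. *)
definition ext_ln :: "ereal \<Rightarrow> ereal" where
  "ext_ln x = (if x \<le> 0 then -\<infinity> else if x = \<infinity> then \<infinity> else ereal (ln (real_of_ereal x)))"

(* Only used for positive exponents p. *)
definition ennreal_powr :: "ennreal \<Rightarrow> real \<Rightarrow> ennreal" where
  "ennreal_powr x p = (if x = \<top> then \<top> else ennreal (enn2real x powr p))"

section \<open>Large deviations\<close>

definition good_rate_function :: "(real \<Rightarrow> ereal) \<Rightarrow> bool" where
  "good_rate_function I \<longleftrightarrow>
     (\<forall>x. 0 \<le> I x) \<and>
     (\<forall>x. I x \<le> Liminf (at x) I) \<and>
     (\<forall>a::real. compact {x. I x \<le> ereal a})"

definition convex_ereal :: "(real \<Rightarrow> ereal) \<Rightarrow> bool" where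
  "convex_ereal I \<longleftrightarrow>
     (\<forall>x y t. 0 \<le> t \<and> t \<le> 1 \<longrightarrow>
        I ((1 - t) * x + t * y) \<le> ereal (1 - t) * I x + ereal t * I y)"

(* Speed n; the variables may live on a different probability space for each n. *)
definition large_deviations_principle ::
    "(nat \<Rightarrow> 'b measure) \<Rightarrow> (nat \<Rightarrow> 'b \<Rightarrow> real) \<Rightarrow> (real \<Rightarrow> ereal) \<Rightarrow> bool" where
  "large_deviations_principle Q Y I \<longleftrightarrow>
     (\<forall>F. closed F \<longrightarrow>
        limsup (\<lambda>n. ext_ln (ereal (measure (Q n) {\<omega> \<in> space (Q n). Y n \<omega> \<in> F})) / ereal (real n))
          \<le> - (INF x\<in>F. I x)) \<and>
     (\<forall>G. open G \<longrightarrow>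
        - (INF x\<in>G. I x)
          \<le> liminf (\<lambda>n. ext_ln (ereal (measure (Q n) {\<omega> \<in> space (Q n). Y n \<omega> \<in> G})) / ereal (real n)))"

section \<open>Euclidean space of variable dimension\<close>

(* Points of n-dimensional space are the functions on {..<n}, extended by undefined;
   the measure is n-dimensional Lebesgue measure on the Borel sets. *)
definition euclid :: "nat \<Rightarrow> (nat \<Rightarrow> real) measure" where
  "euclid n = PiM {..<n} (\<lambda>_. lborel)"

definition origin :: "nat \<Rightarrow> nat \<Rightarrow> real" where
  "origin n = (\<lambda>i\<in>{..<n}. 0)"

definition euclid_cball :: "nat \<Rightarrow> (nat \<Rightarrow> real) \<Rightarrow> real \<Rightarrow> (nat \<Rightarrow> real) set" where
  "euclid_cball n t r = {x \<in> space (euclid n). L2_set (\<lambda>i. x i - t i) {..<n} \<le> r}"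

section \<open>Marked Poisson processes and the Boolean model\<close>

definition point_count :: "(nat \<Rightarrow> 'a \<Rightarrow> nat \<Rightarrow> real) \<Rightarrow> (nat \<Rightarrow> real) set \<Rightarrow> 'a \<Rightarrow> ennreal" where
  "point_count T A \<omega> = emeasure (count_space UNIV) {k. T k \<omega> \<in> A}"

(* The points are enumerated by all of nat: for positive intensity and n \<ge> 1 there are almost
   surely infinitely many. *)
locale poisson_process = prob_space M
  for M :: "'a measure" and n :: nat and intensity :: real
    and T :: "nat \<Rightarrow> 'a \<Rightarrow> nat \<Rightarrow> real" +
  assumes point_measurable: "\<And>k. T k \<in> measurable M (euclid n)"
    and count_poisson:
      "\<And>A j. A \<in> sets (euclid n) \<Longrightarrow> emeasure (euclid n) A < \<infinity> \<Longrightarrow>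
         prob {\<omega> \<in> space M. point_count T A \<omega> = of_nat j} =
           (intensity * measure (euclid n) A) ^ j / fact j * exp (- (intensity * measure (euclid n) A))"
    and count_indep:
      "\<And>(A :: nat \<Rightarrow> (nat \<Rightarrow> real) set) J. finite J \<Longrightarrow> disjoint_family_on A J \<Longrightarrow>
         (\<And>j. j \<in> J \<Longrightarrow> A j \<in> sets (euclid n) \<and> emeasure (euclid n) (A j) < \<infinity>) \<Longrightarrow>
         indep_vars (\<lambda>_. borel) (\<lambda>j. point_count T (A j)) J"

locale iid_marked_poisson_process = poisson_process M n intensity T
  for M :: "'a measure" and n :: nat and intensity :: real
    and T :: "nat \<Rightarrow> 'a \<Rightarrow> nat \<Rightarrow> real" +
  fixes mark_law :: "real measure" and X :: "nat \<Rightarrow> 'a \<Rightarrow> real"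
  assumes marks_distr: "\<And>k. distr M borel (X k) = mark_law"
    and marks_indep: "indep_vars (\<lambda>_. borel) X UNIV"
    and marks_indep_points:
      "indep_set
         (sets (vimage_algebra (space M) (\<lambda>\<omega> k. T k \<omega>) (PiM UNIV (\<lambda>_. euclid n))))
         (sets (vimage_algebra (space M) (\<lambda>\<omega> k. X k \<omega>) (PiM UNIV (\<lambda>_. borel))))"

definition boolean_model ::
    "nat \<Rightarrow> (nat \<Rightarrow> 'a \<Rightarrow> nat \<Rightarrow> real) \<Rightarrow> (nat \<Rightarrow> 'a \<Rightarrow> real) \<Rightarrow> 'a \<Rightarrow> (nat \<Rightarrow> real) set" where
  "boolean_model n T X \<omega> = (\<Union>k. euclid_cball n (T k \<omega>) (X k \<omega> * sqrt (real n)))"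

definition volume_fraction ::
    "'a measure \<Rightarrow> nat \<Rightarrow> (nat \<Rightarrow> 'a \<Rightarrow> nat \<Rightarrow> real) \<Rightarrow> (nat \<Rightarrow> 'a \<Rightarrow> real) \<Rightarrow> real" where
  "volume_fraction M n T X = measure M {\<omega> \<in> space M. origin n \<in> boolean_model n T X \<omega>}"

definition vacancy ::
    "'a measure \<Rightarrow> nat \<Rightarrow> (nat \<Rightarrow> 'a \<Rightarrow> nat \<Rightarrow> real) \<Rightarrow> (nat \<Rightarrow> 'a \<Rightarrow> real) \<Rightarrow> real" where
  "vacancy M n T X = measure M {\<omega> \<in> space M. origin n \<notin> boolean_model n T X \<omega>}"

(* One model in each dimension n \<ge> 1, with intensity exp (n r\<^sub>n), r\<^sub>n \<rightarrow> \<rho>, and marks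
   distributed as Y n. *)
definition boolean_model_sequence ::
    "(nat \<Rightarrow> 'b measure) \<Rightarrow> (nat \<Rightarrow> 'b \<Rightarrow> real) \<Rightarrow> real \<Rightarrow> (nat \<Rightarrow> real) \<Rightarrow>
     (nat \<Rightarrow> 'a measure) \<Rightarrow> (nat \<Rightarrow> nat \<Rightarrow> 'a \<Rightarrow> nat \<Rightarrow> real) \<Rightarrow> (nat \<Rightarrow> nat \<Rightarrow> 'a \<Rightarrow> real) \<Rightarrow> bool" where
  "boolean_model_sequence Q Y \<rho> r M T X \<longleftrightarrow>
     r \<longlonglongrightarrow> \<rho> \<and>
     (\<forall>n\<ge>1. iid_marked_poisson_process (M n) n (exp (real n * r n)) (T n)
              (distr (Q n) borel (Y n)) (X n))"

(* p \<rho> n is the volume fraction in dimension n for limiting parameter \<rho>; at most one \<tau> qualifies. *)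
definition is_volume_fraction_threshold :: "(real \<Rightarrow> nat \<Rightarrow> real) \<Rightarrow> real \<Rightarrow> bool" where
  "is_volume_fraction_threshold p \<tau> \<longleftrightarrow>
     (\<forall>\<rho>. \<rho> < \<tau> \<longrightarrow> p \<rho> \<longlonglongrightarrow> 0) \<and> (\<forall>\<rho>. \<rho> > \<tau> \<longrightarrow> p \<rho> \<longlonglongrightarrow> 1)"

end

theory Submission
  imports Defs
begin

text \<open>
  By the generating functional of the Poisson process, the vacancy equals \<open>exp (- \<lambda>\<^sub>n)\<close>, where
  \<open>\<lambda>\<^sub>n = e\<^bsup>n r\<^sub>n\<^esup> \<cdot> vol (B(0, \<surd>n)) \<cdot> E [X\<^sub>n\<^sup>n]\<close> is the mean number of balls that cover the origin.
  Since \<open>(1/n) ln vol (B(0, \<surd>n)) \<rightarrow> (1/2) ln (2\<pi>e)\<close>, everything reduces to the Varadhan-type limit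
  \<open>(1/n) ln E [X\<^sub>n\<^sup>n] \<rightarrow> sup {ln R - I R | R \<ge> R\<^sup>*}\<close>. Radii below \<open>R\<^sup>*\<close> do not matter because
  \<open>I R\<^sup>* = 0\<close>; the moment assumption makes the contribution of large radii negligible; the
  range in between is cut into finitely many pieces by a geometric grid.
\<close>

section \<open>The generating functional of a Poisson process\<close>

text \<open>The locale describes the points through counts on sets of finite volume only, and the
  marks through independence; no Poisson process of marked points on a larger space is given. The
  marks are therefore integrated out first: given its position \<open>t\<close>, a point covers the
  origin with probability \<open>cover_prob t\<close>, independently of the others, and the vacancy
  becomes the generating functional of the points at \<open>cover_prob\<close>. One exponential rate
  for the mean \<lambda> then serves both regimes, because minus the logarithm of the vacancy is
  exactly \<lambda>, while 1 - exp (- \<lambda>) is comparable to \<lambda> when \<lambda> is small.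
  The infimum may start at \<open>Rstar\<close> because smaller radii contribute at most
  \<open>Rstar ^ n\<close> to the moment, and ln Rstar = ln Rstar - I Rstar is itself one of the
  competitors in the supremum. Large deviations bound probabilities, not expectations of unbounded
  variables; hence the tail bound from the moment assumption enters twice, for the n-th moment and
  already for the mean in the proof that \<open>I Rstar = 0\<close>.\<close>

text \<open>Holds for infinite sets too, where \<open>card\<close> and
  \<open>enn2real \<top>\<close> both default to 0. It transfers measurability and independence from
  the counts to powers with exponent \<open>card\<close>.\<close>

lemma card_eq_point_count: "card {k. T k \<omega> \<in> A} = nat \<lfloor>enn2real (point_count T A \<omega>)\<rfloor>"
  by (cases "finite {k. T k \<omega> \<in> A}") (auto simp: point_count_def)

lemma (in poisson_process) point_count_measurable:
  assumes "A \<in> sets (euclid n)" "emeasure (euclid n) A < \<infinity>"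
  shows "point_count T A \<in> borel_measurable M"
  using count_indep[of "{0}" "\<lambda>_. A"] assms by (auto simp: indep_vars_def disjoint_family_on_def)

text \<open>\<open>count_poisson\<close> speaks of finite values only; since the Poisson weights sum
  to 1, no mass is left for an infinite count.\<close>

lemma (in poisson_process) AE_point_count_finite:
  assumes A: "A \<in> sets (euclid n)" "emeasure (euclid n) A < \<infinity>"
  shows "AE \<omega> in M. \<exists>j::nat. point_count T A \<omega> = of_nat j"
proof -
  note [measurable] = point_count_measurable[OF A]
  define \<mu> where "\<mu> = intensity * measure (euclid n) A"
  define E where "E j = {\<omega> \<in> space M. point_count T A \<omega> = of_nat j}" for j :: nat
  have E[measurable]: "E j \<in> events" for j unfolding E_def by measurable
  have "(\<lambda>j. prob (E j)) sums prob (\<Union>j. E j)"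
    by (rule finite_measure_UNION) (auto simp: disjoint_family_on_def E_def)
  moreover have "(\<lambda>j. \<mu> ^ j / fact j * exp (- \<mu>)) sums (exp \<mu> * exp (- \<mu>))"
    by (rule sums_mult2) (use exp_converges[of \<mu>] in \<open>simp add: divide_inverse_commute\<close>)
  moreover have "prob (E j) = \<mu> ^ j / fact j * exp (- \<mu>)" for j
    unfolding E_def \<mu>_def by (rule count_poisson[OF A])
  ultimately have "prob (\<Union>j. E j) = 1"
    by (simp add: sums_unique2 exp_minus)
  then have "AE \<omega> in M. \<omega> \<in> (\<Union>j. E j)"
    by (subst AE_in_set_eq_1) auto
  then show ?thesis by (auto simp: E_def)
qed

text \<open>The probability generating function of the Poisson law, obtained by splitting along the
  value of the count.\<close>

lemma (in poisson_process) nn_integral_power_card: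
  assumes A: "A \<in> sets (euclid n)" "emeasure (euclid n) A < \<infinity>" and q: "0 \<le> q"
  shows "(\<integral>\<^sup>+\<omega>. ennreal (q ^ card {k. T k \<omega> \<in> A}) \<partial>M) =
    ennreal (exp (- (intensity * measure (euclid n) A * (1 - q))))"
proof -
  note [measurable] = point_count_measurable[OF A]
  define \<mu> where "\<mu> = intensity * measure (euclid n) A"
  define E where "E j = {\<omega> \<in> space M. point_count T A \<omega> = of_nat j}" for j :: nat
  have E[measurable]: "E j \<in> events" for j unfolding E_def by measurable
  have disj: "disjoint_family E" by (auto simp: disjoint_family_on_def E_def)
  have pE: "prob (E j) = \<mu> ^ j / fact j * exp (- \<mu>)" for j
    unfolding E_def \<mu>_def by (rule count_poisson[OF A])
  \<comment> \<open>Only almost everywhere: at an infinite count the left side is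
    \<open>q ^ 0 = 1\<close> and the right side is 0.\<close>
  have "AE \<omega> in M. ennreal (q ^ card {k. T k \<omega> \<in> A}) = (\<Sum>j. ennreal (q ^ j) * indicator (E j) \<omega>)"
    using AE_point_count_finite[OF A] AE_space
  proof eventually_elim
    case (elim \<omega>)
    then obtain j :: nat where j: "point_count T A \<omega> = of_nat j" by auto
    then have "\<omega> \<in> E j" using elim by (auto simp: E_def)
    then have "(\<Sum>j. ennreal (q ^ j) * indicator (E j) \<omega>) = ennreal (q ^ j)"
      using disj by (intro suminf_cmult_indicator)
    moreover have "card {k. T k \<omega> \<in> A} = j" using j by (simp add: card_eq_point_count)
    ultimately show ?case by simp
  qed
  then have "(\<integral>\<^sup>+\<omega>. ennreal (q ^ card {k. T k \<omega> \<in> A}) \<partial>M) =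
      (\<integral>\<^sup>+\<omega>. (\<Sum>j. ennreal (q ^ j) * indicator (E j) \<omega>) \<partial>M)"
    by (rule nn_integral_cong_AE)
  also have "\<dots> = (\<Sum>j. \<integral>\<^sup>+\<omega>. ennreal (q ^ j) * indicator (E j) \<omega> \<partial>M)"
    by (rule nn_integral_suminf) measurable
  also have "\<dots> = (\<Sum>j. ennreal (q ^ j * prob (E j)))"
    using q by (intro suminf_cong) (simp add: nn_integral_cmult emeasure_eq_measure ennreal_mult)
  also have "\<dots> = ennreal (exp (q * \<mu>) * exp (- \<mu>))"
  proof (rule suminf_ennreal_eq)
    have "(\<lambda>j. ((q * \<mu>) ^ j / fact j) * exp (- \<mu>)) sums (exp (q * \<mu>) * exp (- \<mu>))"
      by (rule sums_mult2) (use exp_converges[of "q * \<mu>"] in \<open>simp add: divide_inverse_commute\<close>)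
    then show "(\<lambda>j. q ^ j * prob (E j)) sums (exp (q * \<mu>) * exp (- \<mu>))"
      by (simp add: pE power_mult_distrib mult_ac)
  qed (use q in auto)
  also have "exp (q * \<mu>) * exp (- \<mu>) = exp (- (\<mu> * (1 - q)))"
    by (simp add: exp_add[symmetric] algebra_simps)
  finally show ?thesis by (simp add: \<mu>_def)
qed

text \<open>The infimum of the partial products stands for the infinite product, which then commutes
  with monotone limits.\<close>
lemma INF_prod_step_function:
  fixes T :: "nat \<Rightarrow> 'a \<Rightarrow> 'b"
  assumes J: "finite J" and disj: "disjoint_family_on A J"
    and fin: "\<And>j. j \<in> J \<Longrightarrow> finite {k. T k \<omega> \<in> A j}"
    and c: "\<And>j. j \<in> J \<Longrightarrow> 0 \<le> c j \<and> c j \<le> (1::real)"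
  shows "(INF K. ennreal (\<Prod>k<K. 1 - (\<Sum>j\<in>J. c j * indicator (A j) (T k \<omega>)))) =
    (\<Prod>j\<in>J. ennreal ((1 - c j) ^ card {k. T k \<omega> \<in> A j}))"
proof -
  define S where "S = (\<Union>j\<in>J. {k. T k \<omega> \<in> A j})"
  define g where "g k = 1 - (\<Sum>j\<in>J. c j * indicator (A j) (T k \<omega>))" for k
  have finS: "finite S" using J fin by (auto simp: S_def)
  have g_in: "g k = 1 - c j" if "j \<in> J" "T k \<omega> \<in> A j" for j k
  proof -
    have "(\<Sum>i\<in>J. c i * indicator (A i) (T k \<omega>)) = (\<Sum>i\<in>J. if i = j then c j else 0)"
      using that disj by (intro sum.cong) (auto simp: disjoint_family_on_def indicator_def)
    then show ?thesis using that J by (simp add: g_def)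
  qed
  have g_out: "g k = 1" if "k \<notin> S" for k
    using that by (auto simp: g_def S_def indicator_def intro!: sum.neutral)
  have g01: "0 \<le> g k \<and> g k \<le> 1" for k
    using g_in[of _ k] g_out[of k] c by (cases "k \<in> S") (auto simp: S_def)
  have prodS: "(\<Prod>k\<in>S. g k) = (\<Prod>j\<in>J. (1 - c j) ^ card {k. T k \<omega> \<in> A j})"
  proof -
    have "(\<Prod>k\<in>S. g k) = (\<Prod>j\<in>J. \<Prod>k\<in>{k. T k \<omega> \<in> A j}. g k)"
      unfolding S_def using J fin disj
      by (intro prod.UNION_disjoint) (auto simp: disjoint_family_on_def)
    also have "\<dots> = (\<Prod>j\<in>J. \<Prod>k\<in>{k. T k \<omega> \<in> A j}. 1 - c j)"
      by (intro prod.cong refl) (auto simp: g_in)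
    finally show ?thesis by simp
  qed
  \<comment> \<open>All factors are at most 1 and equal 1 outside the finite set \<open>S\<close>,
    so a partial product that misses some of \<open>S\<close> can only be larger. Equality holds as
    soon as \<open>K\<close> passes all of \<open>S\<close>, which identifies the infimum.\<close>
  have le: "(\<Prod>k\<in>S. g k) \<le> (\<Prod>k<K. g k)" for K
  proof -
    have "(\<Prod>k<K. g k) = (\<Prod>k\<in>{..<K} \<inter> S. g k)"
      by (rule prod.mono_neutral_right) (auto simp: g_out)
    moreover have "(\<Prod>k\<in>S. g k) \<le> (\<Prod>k\<in>{..<K} \<inter> S. g k)"
    proof -
      have "(\<Prod>k\<in>S. g k) = (\<Prod>k\<in>S - {..<K}. g k) * (\<Prod>k\<in>{..<K} \<inter> S. g k)"
        using finS by (subst prod.subset_diff[of "{..<K} \<inter> S" S]) (auto intro!: arg_cong2[where f="(*)"] prod.cong)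
      also have "\<dots> \<le> 1 * (\<Prod>k\<in>{..<K} \<inter> S. g k)"
        using g01 by (intro mult_right_mono prod_le_1 prod_nonneg) auto
      finally show ?thesis by simp
    qed
    ultimately show ?thesis by simp
  qed
  obtain K where K: "S \<subseteq> {..<K}" using finS finite_nat_bounded by blast
  have eqK: "(\<Prod>k<K. g k) = (\<Prod>k\<in>S. g k)"
    by (rule prod.mono_neutral_right) (use K g_out in auto)
  have "(INF K. ennreal (\<Prod>k<K. g k)) = ennreal (\<Prod>k\<in>S. g k)"
    using le eqK by (intro antisym INF_greatest INF_lower2[of K] ennreal_leI) auto
  also have "\<dots> = (\<Prod>j\<in>J. ennreal ((1 - c j) ^ card {k. T k \<omega> \<in> A j}))"
    unfolding prodS using c by (subst prod_ennreal) auto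
  finally show ?thesis by (simp add: g_def)
qed

text \<open>The infinite product groups into one power per set \<open>A j\<close>; independence of
  the counts splits the expectation, and each factor is the generating function at
  \<open>1 - c j\<close>.\<close>

lemma (in poisson_process) nn_integral_step_function:
  fixes A :: "nat \<Rightarrow> (nat \<Rightarrow> real) set"
  assumes J: "finite J" and disj: "disjoint_family_on A J"
    and A: "\<And>j. j \<in> J \<Longrightarrow> A j \<in> sets (euclid n) \<and> emeasure (euclid n) (A j) < \<infinity>"
    and c: "\<And>j. j \<in> J \<Longrightarrow> 0 \<le> c j \<and> c j \<le> (1::real)"
  shows "(\<integral>\<^sup>+\<omega>. (INF K. ennreal (\<Prod>k<K. 1 - (\<Sum>j\<in>J. c j * indicator (A j) (T k \<omega>)))) \<partial>M) =
    ennreal (exp (- (intensity * (\<Sum>j\<in>J. c j * measure (euclid n) (A j)))))"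
proof -
  have "AE \<omega> in M. \<forall>j\<in>J. \<exists>i::nat. point_count T (A j) \<omega> = of_nat i"
    using J A AE_point_count_finite by (intro AE_finite_allI) auto
  then have "AE \<omega> in M. \<forall>j\<in>J. finite {k. T k \<omega> \<in> A j}"
    by eventually_elim
      (metis point_count_def emeasure_count_space_infinite subset_UNIV ennreal_of_nat_neq_top infinity_ennreal_def)
  then have "AE \<omega> in M. (INF K. ennreal (\<Prod>k<K. 1 - (\<Sum>j\<in>J. c j * indicator (A j) (T k \<omega>)))) =
    (\<Prod>j\<in>J. ennreal ((1 - c j) ^ card {k. T k \<omega> \<in> A j}))"
    by eventually_elim (intro INF_prod_step_function J disj c, auto)
  then have "(\<integral>\<^sup>+\<omega>. (INF K. ennreal (\<Prod>k<K. 1 - (\<Sum>j\<in>J. c j * indicator (A j) (T k \<omega>)))) \<partial>M) =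
      (\<integral>\<^sup>+\<omega>. (\<Prod>j\<in>J. ennreal ((1 - c j) ^ card {k. T k \<omega> \<in> A j})) \<partial>M)"
    by (rule nn_integral_cong_AE)
  also have "\<dots> = (\<Prod>j\<in>J. \<integral>\<^sup>+\<omega>. ennreal ((1 - c j) ^ card {k. T k \<omega> \<in> A j}) \<partial>M)"
  proof (rule indep_vars_nn_integral[OF J])
    have "indep_vars (\<lambda>_. borel) (\<lambda>j \<omega>. (\<lambda>x. ennreal ((1 - c j) ^ nat \<lfloor>enn2real x\<rfloor>)) (point_count T (A j) \<omega>)) J"
      by (rule indep_vars_compose2[OF count_indep[OF J disj A]]) auto
    then show "indep_vars (\<lambda>_. borel) (\<lambda>j \<omega>. ennreal ((1 - c j) ^ card {k. T k \<omega> \<in> A j})) J"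
      by (simp add: card_eq_point_count)
  qed auto
  also have "\<dots> = (\<Prod>j\<in>J. ennreal (exp (- (intensity * measure (euclid n) (A j) * c j))))"
    using A c by (intro prod.cong refl) (subst nn_integral_power_card, auto)
  also have "\<dots> = ennreal (exp (- (intensity * (\<Sum>j\<in>J. c j * measure (euclid n) (A j)))))"
    by (subst prod_ennreal) (auto simp: exp_sum[OF J, symmetric] sum_distrib_left sum_negf mult_ac)
  finally show ?thesis .
qed

lemma sigma_finite_euclid: "sigma_finite_measure (euclid n)"
proof -
  interpret product_sigma_finite "\<lambda>_::nat. lborel :: real measure" ..
  show ?thesis unfolding euclid_def by (rule sigma_finite) simp
qed

lemma (in poisson_process) nn_integral_simple_function:
  assumes g: "simple_function (euclid n) g" and g01: "\<And>x. 0 \<le> g x \<and> g x \<le> (1::real)"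
    and fin: "emeasure (euclid n) {x \<in> space (euclid n). g x \<noteq> 0} < \<infinity>"
  shows "\<exists>v\<ge>0. (\<integral>\<^sup>+x. ennreal (g x) \<partial>euclid n) = ennreal v \<and>
    (\<integral>\<^sup>+\<omega>. (INF K. ennreal (\<Prod>k<K. 1 - g (T k \<omega>))) \<partial>M) = ennreal (exp (- (intensity * v)))"
proof -
  \<comment> \<open>The value 0 is left out: its level set may have infinite volume, and it
    contributes only factors 1 to the product.\<close>
  define V where "V = g ` space (euclid n) - {0}"
  have "finite V" using simple_functionD(1)[OF g] by (simp add: V_def)
  \<comment> \<open>The remaining values are numbered because \<open>count_indep\<close> takes
    families indexed by naturals.\<close>
  then obtain c where c: "bij_betw c {0..<card V} V"
    using ex_bij_betw_nat_finite by blast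
  define J where "J = {0..<card V}"
  define A where "A j = g -` {c j} \<inter> space (euclid n)" for j
  have cV: "c j \<in> V" if "j \<in> J" for j using c that by (auto simp: bij_betw_def J_def)
  have c01: "0 \<le> c j \<and> c j \<le> 1" if "j \<in> J" for j
    using cV[OF that] g01 by (auto simp: V_def)
  have Aset: "A j \<in> sets (euclid n)" for j
    unfolding A_def by (rule simple_functionD(2)[OF g])
  have Nset: "{x \<in> space (euclid n). g x \<noteq> 0} \<in> sets (euclid n)"
  proof -
    have "{x \<in> space (euclid n). g x \<noteq> 0} = g -` (- {0}) \<inter> space (euclid n)" by auto
    then show ?thesis using simple_functionD(2)[OF g] by metis
  qed
  have Afin: "emeasure (euclid n) (A j) < \<infinity>" if "j \<in> J" for j
    using cV[OF that] fin by (intro le_less_trans[OF emeasure_mono[OF _ Nset] fin]) (auto simp: A_def V_def)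
  have J: "finite J" by (simp add: J_def)
  have disj: "disjoint_family_on A J"
    using c by (auto simp: disjoint_family_on_def A_def J_def bij_betw_def inj_on_def)
  have g_eq: "g x = (\<Sum>j\<in>J. c j * indicator (A j) x)" if x: "x \<in> space (euclid n)" for x
  proof (cases "g x = 0")
    case True
    then show ?thesis using cV by (auto simp: A_def V_def indicator_def intro!: sum.neutral)
  next
    case False
    then have "g x \<in> V" using x by (auto simp: V_def)
    then obtain i where i: "i \<in> J" "g x = c i"
      using bij_betw_imp_surj_on[OF c] unfolding J_def by (metis imageE)
    have "(\<Sum>j\<in>J. c j * indicator (A j) x) = (\<Sum>j\<in>J. if j = i then c i else 0)"
      using i x c by (intro sum.cong) (auto simp: A_def indicator_def bij_betw_def J_def inj_on_def)
    then show ?thesis using i J by simp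
  qed
  define v where "v = (\<Sum>j\<in>J. c j * measure (euclid n) (A j))"
  have "(\<integral>\<^sup>+x. ennreal (g x) \<partial>euclid n) = (\<integral>\<^sup>+x. (\<Sum>j\<in>J. ennreal (c j) * indicator (A j) x) \<partial>euclid n)"
    using c01 by (intro nn_integral_cong)
      (auto simp: g_eq sum_ennreal[symmetric] ennreal_mult' ennreal_indicator intro!: sum.cong)
  also have "\<dots> = (\<Sum>j\<in>J. ennreal (c j) * emeasure (euclid n) (A j))"
    using Aset by (subst nn_integral_sum) (auto intro!: sum.cong nn_integral_cmult_indicator)
  also have "\<dots> = ennreal v"
  proof -
    have "(\<Sum>j\<in>J. ennreal (c j) * emeasure (euclid n) (A j)) = (\<Sum>j\<in>J. ennreal (c j * measure (euclid n) (A j)))"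
      using c01 Afin by (intro sum.cong refl) (auto simp: ennreal_mult emeasure_eq_ennreal_measure less_top)
    then show ?thesis using c01 by (simp add: v_def sum_ennreal)
  qed
  finally have 1: "(\<integral>\<^sup>+x. ennreal (g x) \<partial>euclid n) = ennreal v" .
  have "(\<integral>\<^sup>+\<omega>. (INF K. ennreal (\<Prod>k<K. 1 - g (T k \<omega>))) \<partial>M) =
      (\<integral>\<^sup>+\<omega>. (INF K. ennreal (\<Prod>k<K. 1 - (\<Sum>j\<in>J. c j * indicator (A j) (T k \<omega>)))) \<partial>M)"
    using measurable_space[OF point_measurable] by (intro nn_integral_cong) (simp add: g_eq)
  also have "\<dots> = ennreal (exp (- (intensity * v)))"
    unfolding v_def using J disj Aset Afin c01 by (intro nn_integral_step_function) auto
  finally have 2: "(\<integral>\<^sup>+\<omega>. (INF K. ennreal (\<Prod>k<K. 1 - g (T k \<omega>))) \<partial>M) = ennreal (exp (- (intensity * v)))" .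
  have "v \<ge> 0" unfolding v_def using c01 by (intro sum_nonneg) auto
  with 1 2 show ?thesis by blast
qed

text \<open>Approximation of \<open>f\<close> from below by simple functions \<open>g i\<close>. The
  integrals over space increase to \<open>v\<close>, while the infinite products decrease, so
  monotone convergence is applied once in each direction.\<close>

lemma (in poisson_process) generating_functional:
  assumes f[measurable]: "f \<in> borel_measurable (euclid n)" and f01: "\<And>x. 0 \<le> f x \<and> f x \<le> (1::real)"
    and v: "(\<integral>\<^sup>+x. ennreal (f x) \<partial>euclid n) = ennreal v" "v \<ge> 0"
  shows "(\<integral>\<^sup>+\<omega>. (INF K. ennreal (\<Prod>k<K. 1 - f (T k \<omega>))) \<partial>M) = ennreal (exp (- (intensity * v)))"
proof -
  interpret E: sigma_finite_measure "euclid n" by (rule sigma_finite_euclid)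
  note [measurable] = point_measurable
  obtain S :: "nat \<Rightarrow> (nat \<Rightarrow> real) set" where S: "range S \<subseteq> sets (euclid n)" "(\<Union>i. S i) = space (euclid n)"
      "\<And>i. emeasure (euclid n) (S i) \<noteq> \<infinity>" "incseq S"
    using E.sigma_finite_incseq by blast
  have [measurable]: "S i \<in> sets (euclid n)" for i using S(1) by auto
  obtain U where U: "\<And>i. simple_function (euclid n) (U i)" "incseq U" "\<And>i x. U i x < top"
      "\<And>x. (SUP i. U i x) = ennreal (f x)"
    by (rule borel_measurable_implies_simple_function_sequence'[of "\<lambda>x. ennreal (f x)" "euclid n"]) auto
  \<comment> \<open>The factor \<open>indicator (S i)\<close> gives \<open>g i\<close> a support of
    finite volume, as the simple-function case demands.\<close>
  define g where "g i x = enn2real (U i x) * indicator (S i) x" for i x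
  have g: "simple_function (euclid n) (g i)" for i
    unfolding g_def using U(1) by (intro simple_function_mult simple_function_compose1[where g=enn2real]) auto
  have gmeas[measurable]: "g i \<in> borel_measurable (euclid n)" for i
    using g by (rule borel_measurable_simple_function)
  have Ule: "U i x \<le> ennreal (f x)" for i x
    unfolding U(4)[symmetric] by (rule SUP_upper) simp
  have gf: "g i x \<le> f x" for i x
    using Ule[of i x] f01[of x] by (auto simp: g_def indicator_def intro!: enn2real_leI)
  have g01: "0 \<le> g i x \<and> g i x \<le> 1" for i x
    using gf[of i x] f01[of x] by (auto simp: g_def)
  have ginc: "g i x \<le> g (Suc i) x" for i x
  proof -
    have "U i x \<le> U (Suc i) x" using U(2) by (simp add: incseq_Suc_iff le_fun_def)
    then have "enn2real (U i x) \<le> enn2real (U (Suc i) x)" using U(3) by (intro enn2real_mono) auto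
    moreover have "indicator (S i) x \<le> (indicator (S (Suc i)) x :: real)"
      using S(4) by (auto simp: indicator_def incseq_Suc_iff)
    ultimately show ?thesis unfolding g_def by (intro mult_mono) auto
  qed
  have gfin: "emeasure (euclid n) {x \<in> space (euclid n). g i x \<noteq> 0} < \<infinity>" for i
  proof -
    have "emeasure (euclid n) {x \<in> space (euclid n). g i x \<noteq> 0} \<le> emeasure (euclid n) (S i)"
      by (intro emeasure_mono) (auto simp: g_def indicator_def split: if_splits)
    also have "\<dots> < \<infinity>" using S(3)[of i] by (simp add: less_top)
    finally show ?thesis .
  qed
  have glim: "(\<lambda>i. g i x) \<longlonglongrightarrow> f x" if x: "x \<in> space (euclid n)" for x
  proof -
    obtain i0 where "x \<in> S i0" using x S(2) by auto
    then have "eventually (\<lambda>i. x \<in> S i) sequentially"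
      using S(4) by (auto simp: eventually_sequentially incseq_def intro!: exI[of _ i0])
    then have ev: "eventually (\<lambda>i. enn2real (U i x) = g i x) sequentially"
      by eventually_elim (simp add: g_def)
    have "(\<lambda>i. U i x) \<longlonglongrightarrow> ennreal (f x)"
      unfolding U(4)[symmetric] using U(2) by (intro LIMSEQ_SUP) (auto simp: incseq_def le_fun_def)
    then have "(\<lambda>i. enn2real (U i x)) \<longlonglongrightarrow> f x"
      using f01[of x] tendsto_enn2real by blast
    then show ?thesis using ev by (rule Lim_transform_eventually)
  qed
  have "\<forall>i. \<exists>w\<ge>0. (\<integral>\<^sup>+x. ennreal (g i x) \<partial>euclid n) = ennreal w \<and>
    (\<integral>\<^sup>+\<omega>. (INF K. ennreal (\<Prod>k<K. 1 - g i (T k \<omega>))) \<partial>M) = ennreal (exp (- (intensity * w)))"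
    using nn_integral_simple_function[OF g g01 gfin] by blast
  then obtain w where w: "\<And>i. w i \<ge> 0" "\<And>i. (\<integral>\<^sup>+x. ennreal (g i x) \<partial>euclid n) = ennreal (w i)"
    "\<And>i. (\<integral>\<^sup>+\<omega>. (INF K. ennreal (\<Prod>k<K. 1 - g i (T k \<omega>))) \<partial>M) = ennreal (exp (- (intensity * w i)))"
    by metis
  have wlim: "w \<longlonglongrightarrow> v"
  proof -
    have inc: "incseq (\<lambda>i x. ennreal (g i x))" using ginc by (auto simp: incseq_Suc_iff le_fun_def intro!: ennreal_leI)
    have "(\<lambda>i. ennreal (w i)) \<longlonglongrightarrow> (SUP i. ennreal (w i))"
    proof (rule LIMSEQ_SUP)
      show "incseq (\<lambda>i. ennreal (w i))"
        unfolding w(2)[symmetric] using ginc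
        by (intro incseq_SucI nn_integral_mono ennreal_leI)
    qed
    also have "(SUP i. ennreal (w i)) = (\<integral>\<^sup>+x. (SUP i. ennreal (g i x)) \<partial>euclid n)"
      unfolding w(2)[symmetric] by (rule nn_integral_monotone_convergence_SUP[symmetric, OF inc]) simp
    also have "\<dots> = (\<integral>\<^sup>+x. ennreal (f x) \<partial>euclid n)"
    proof (rule nn_integral_cong)
      fix x assume "x \<in> space (euclid n)"
      then have "(\<lambda>i. ennreal (g i x)) \<longlonglongrightarrow> ennreal (f x)" by (intro tendsto_ennrealI glim)
      moreover have "(\<lambda>i. ennreal (g i x)) \<longlonglongrightarrow> (SUP i. ennreal (g i x))"
        using inc by (intro LIMSEQ_SUP) (auto simp: incseq_def le_fun_def)
      ultimately show "(SUP i. ennreal (g i x)) = ennreal (f x)" by (rule LIMSEQ_unique[symmetric])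
    qed
    finally have "(\<lambda>i. ennreal (w i)) \<longlonglongrightarrow> ennreal v" using v by simp
    then show ?thesis using w(1) v(2) by (subst (asm) tendsto_ennreal_iff) auto
  qed
  define F where "F i \<omega> = (INF K. ennreal (\<Prod>k<K. 1 - g i (T k \<omega>)))" for i \<omega>
  have Fdec: "F (Suc i) \<omega> \<le> F i \<omega>" for i \<omega>
    unfolding F_def using ginc g01
    by (intro INF_mono' ennreal_leI prod_mono) auto
  have [measurable]: "F i \<in> borel_measurable M" for i
    unfolding F_def by measurable
  \<comment> \<open>For fixed \<open>K\<close> the product is finite and converges as
    \<open>g i\<close> tends to \<open>f\<close>; the two infima, over \<open>i\<close> and over
    \<open>K\<close>, then commute.\<close>
  have F_INF: "(INF i. F i \<omega>) = (INF K. ennreal (\<Prod>k<K. 1 - f (T k \<omega>)))" if "\<omega> \<in> space M" for \<omega>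
  proof -
    have "(INF i. ennreal (\<Prod>k<K. 1 - g i (T k \<omega>))) = ennreal (\<Prod>k<K. 1 - f (T k \<omega>))" for K
    proof (rule LIMSEQ_unique)
      show "(\<lambda>i. ennreal (\<Prod>k<K. 1 - g i (T k \<omega>))) \<longlonglongrightarrow> (INF i. ennreal (\<Prod>k<K. 1 - g i (T k \<omega>)))"
        using ginc g01 by (intro LIMSEQ_INF decseq_SucI ennreal_leI prod_mono) auto
      show "(\<lambda>i. ennreal (\<Prod>k<K. 1 - g i (T k \<omega>))) \<longlonglongrightarrow> ennreal (\<Prod>k<K. 1 - f (T k \<omega>))"
        using measurable_space[OF point_measurable that] by (intro tendsto_intros glim)
    qed
    then show ?thesis unfolding F_def by (subst INF_commute) simp
  qed
  have "(\<integral>\<^sup>+\<omega>. (INF K. ennreal (\<Prod>k<K. 1 - f (T k \<omega>))) \<partial>M) = (\<integral>\<^sup>+\<omega>. (INF i. F i \<omega>) \<partial>M)"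
    by (intro nn_integral_cong) (simp add: F_INF)
  also have "\<dots> = (INF i. \<integral>\<^sup>+\<omega>. F i \<omega> \<partial>M)"
  proof (rule nn_integral_monotone_convergence_INF_AE)
    show "(\<integral>\<^sup>+\<omega>. F 0 \<omega> \<partial>M) < \<infinity>" by (simp add: F_def w(3))
  qed (use Fdec in auto)
  also have "\<dots> = ennreal (exp (- (intensity * v)))"
  proof (rule LIMSEQ_unique)
    show "(\<lambda>i. \<integral>\<^sup>+\<omega>. F i \<omega> \<partial>M) \<longlonglongrightarrow> (INF i. \<integral>\<^sup>+\<omega>. F i \<omega> \<partial>M)"
      using Fdec by (intro LIMSEQ_INF decseq_SucI nn_integral_mono)
    show "(\<lambda>i. \<integral>\<^sup>+\<omega>. F i \<omega> \<partial>M) \<longlonglongrightarrow> ennreal (exp (- (intensity * v)))"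
      unfolding F_def w(3) by (intro tendsto_intros wlim)
  qed
  finally show ?thesis .
qed

section \<open>The vacancy of the Boolean model\<close>

lemma space_euclid: "space (euclid n) = ({..<n} \<rightarrow>\<^sub>E UNIV)"
  by (simp add: euclid_def space_PiM)

lemma L2_set_measurable_euclid[measurable]: "(\<lambda>t. L2_set t {..<n}) \<in> borel_measurable (euclid n)"
  unfolding L2_set_def euclid_def by measurable

lemma origin_in_euclid_cball: "origin n \<in> euclid_cball n t r \<longleftrightarrow> L2_set t {..<n} \<le> r"
proof -
  have "L2_set (\<lambda>i. origin n i - t i) {..<n} = L2_set t {..<n}"
    by (auto simp: L2_set_def origin_def intro!: sum.cong arg_cong[where f=sqrt])
  then show ?thesis by (auto simp: euclid_cball_def space_euclid origin_def)
qed

context iid_marked_poisson_process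
begin

text \<open>The retention probability of a position-dependent thinning: the points whose balls cover
  the origin are the retained ones.\<close>

definition cover_prob :: "(nat \<Rightarrow> real) \<Rightarrow> real" where
  "cover_prob t = measure mark_law {x. L2_set t {..<n} \<le> x * sqrt (real n)}"

lemma mark_measurable[measurable]: "X k \<in> borel_measurable M"
  using marks_indep by (auto simp: indep_vars_def)

lemma prob_space_mark_law: "prob_space mark_law"
  using prob_space_distr[OF mark_measurable[of 0]] by (simp add: marks_distr)

lemma sets_mark_law[simp, measurable_cong]: "sets mark_law = sets borel"
  using marks_distr[of 0] by (metis sets_distr)

lemma space_mark_law[simp]: "space mark_law = UNIV"
  using marks_distr[of 0] by (metis space_distr space_borel)

lemma cover_prob_bounds: "0 \<le> cover_prob t \<and> cover_prob t \<le> 1"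
  using prob_space.prob_le_1[OF prob_space_mark_law] by (simp add: cover_prob_def)

text \<open>The integral form gives measurability in \<open>t\<close> and allows Fubini's theorem in
  \<open>nn_integral_cover_prob\<close>.\<close>

lemma ennreal_cover_prob:
  "ennreal (cover_prob t) =
    (\<integral>\<^sup>+x. indicator {x. L2_set t {..<n} \<le> x * sqrt (real n)} x \<partial>mark_law)"
proof -
  interpret P: prob_space mark_law by (rule prob_space_mark_law)
  show ?thesis by (simp add: cover_prob_def P.emeasure_eq_measure)
qed

lemma cover_prob_measurable[measurable]: "cover_prob \<in> borel_measurable (euclid n)"
proof -
  interpret P: prob_space mark_law by (rule prob_space_mark_law)
  have "(\<lambda>t. \<integral>\<^sup>+x. indicator {x. L2_set t {..<n} \<le> x * sqrt (real n)} x \<partial>mark_law)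
      \<in> borel_measurable (euclid n)"
    by measurable
  then have "(\<lambda>t. enn2real (ennreal (cover_prob t))) \<in> borel_measurable (euclid n)"
    unfolding ennreal_cover_prob by measurable
  then show ?thesis using cover_prob_bounds by simp
qed

text \<open>Exchange the integrals: for a fixed mark \<open>x\<close>, the positions
  \<open>t\<close> whose ball covers the origin form a ball of radius \<open>x * sqrt n\<close>.
  This is where the n-th moment of the marks comes from.\<close>

lemma nn_integral_cover_prob:
  assumes n: "n \<ge> 1" and pos: "AE x in mark_law. 0 \<le> x"
  shows "(\<integral>\<^sup>+t. ennreal (cover_prob t) \<partial>euclid n) =
    ennreal (unit_ball_vol n * sqrt n ^ n) * (\<integral>\<^sup>+x. ennreal (x ^ n) \<partial>mark_law)"
proof -
  interpret P: prob_space mark_law by (rule prob_space_mark_law)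
  interpret E: sigma_finite_measure "euclid n" by (rule sigma_finite_euclid)
  interpret pair_sigma_finite "euclid n" mark_law ..
  have ball: "(\<integral>\<^sup>+t. indicator {x. L2_set t {..<n} \<le> x * sqrt (real n)} x \<partial>euclid n) =
      ennreal (unit_ball_vol n * sqrt n ^ n) * ennreal (x ^ n)" if x: "x > 0" for x :: real
  proof -
    let ?r = "x * sqrt n"
    let ?B = "{f. sqrt (\<Sum>i<n. (f i)\<^sup>2) \<le> ?r} \<inter> space (euclid n)"
    have B: "?B \<in> sets (euclid n)"
    proof -
      have "{t \<in> space (euclid n). L2_set t {..<n} \<le> ?r} \<in> sets (euclid n)" by measurable
      also have "{t \<in> space (euclid n). L2_set t {..<n} \<le> ?r} = ?B" by (auto simp: L2_set_def)
      finally show ?thesis .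
    qed
    have "(\<integral>\<^sup>+t. indicator {x. L2_set t {..<n} \<le> x * sqrt (real n)} x \<partial>euclid n) = (\<integral>\<^sup>+t. indicator ?B t \<partial>euclid n)"
      by (intro nn_integral_cong) (auto simp: L2_set_def indicator_def)
    also have "\<dots> = emeasure (euclid n) ?B" using B by simp
    also have "\<dots> = ennreal (unit_ball_vol n * ?r ^ n)"
      using emeasure_cball_aux[of "{..<n}" ?r] x n unfolding euclid_def by simp
    finally show ?thesis using x by (simp add: power_mult_distrib ennreal_mult'[symmetric] mult_ac)
  qed
  \<comment> \<open>A mark 0 leaves only the position at the origin, a null set because
    \<open>n \<ge> 1\<close>; this agrees with \<open>0 ^ n = 0\<close>.\<close>
  have zero: "(\<integral>\<^sup>+t. indicator {x. L2_set t {..<n} \<le> x * sqrt (real n)} x \<partial>euclid n) = 0"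
    if x: "x = 0" for x :: real
  proof -
    have "AE t in euclid n. L2_set t {..<n} \<noteq> 0"
    proof (rule AE_I)
      show "{t \<in> space (euclid n). \<not> L2_set t {..<n} \<noteq> 0} \<subseteq> {origin n}"
        by (auto simp: L2_set_eq_0_iff origin_def space_euclid PiE_def extensional_def)
      have *: "{origin n} = PiE {..<n} (\<lambda>_. {0})"
        by (auto simp: origin_def PiE_def extensional_def)
      interpret F: product_sigma_finite "\<lambda>_::nat. lborel :: real measure" ..
      show "emeasure (euclid n) {origin n} = 0"
        unfolding * euclid_def using n by (subst F.emeasure_PiM) (auto simp: zero_less_iff_neq_zero lessThan_empty_iff)
      show "{origin n} \<in> sets (euclid n)"
        unfolding * euclid_def by (rule sets_PiM_I_finite) auto
    qed
    then have "(\<integral>\<^sup>+t. indicator {x. L2_set t {..<n} \<le> x * sqrt (real n)} x \<partial>euclid n) = (\<integral>\<^sup>+t. 0 \<partial>euclid n)"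
      using L2_set_nonneg[of _ "{..<n}"]
      by (intro nn_integral_cong_AE) (auto simp: x indicator_def order_antisym elim!: eventually_mono)
    then show ?thesis by simp
  qed
  have "(\<integral>\<^sup>+t. ennreal (cover_prob t) \<partial>euclid n) =
      (\<integral>\<^sup>+x. (\<integral>\<^sup>+t. indicator {x. L2_set t {..<n} \<le> x * sqrt (real n)} x \<partial>euclid n) \<partial>mark_law)"
    unfolding ennreal_cover_prob by (rule Fubini'[symmetric]) measurable
  also have "\<dots> = (\<integral>\<^sup>+x. ennreal (unit_ball_vol n * sqrt n ^ n) * ennreal (x ^ n) \<partial>mark_law)"
  proof (rule nn_integral_cong_AE)
    show "AE x in mark_law. (\<integral>\<^sup>+t. indicator {x. L2_set t {..<n} \<le> x * sqrt (real n)} x \<partial>euclid n) =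
        ennreal (unit_ball_vol n * sqrt n ^ n) * ennreal (x ^ n)"
      using pos
    proof eventually_elim
      case (elim x)
      show ?case
      proof (cases "x = 0")
        case True
        then show ?thesis using zero[OF True] n by (simp add: zero_power)
      qed (use ball[of x] elim in auto)
    qed
  qed
  also have "\<dots> = ennreal (unit_ball_vol n * sqrt n ^ n) * (\<integral>\<^sup>+x. ennreal (x ^ n) \<partial>mark_law)"
    by (rule nn_integral_cmult) measurable
  finally show ?thesis .
qed

text \<open>Independence of the two generated sigma-algebras is the product formula on rectangles,
  and these determine the joint law. The product form lets Fubini's theorem play the part of
  conditioning on the points.\<close>

lemma joint_law_points_marks:
  fixes PT PX
  defines "PT \<equiv> PiM UNIV (\<lambda>_::nat. euclid n)" and "PX \<equiv> PiM UNIV (\<lambda>_::nat. borel :: real measure)"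
  shows "(\<lambda>\<omega> k. T k \<omega>) \<in> measurable M PT" and "(\<lambda>\<omega> k. X k \<omega>) \<in> measurable M PX"
    and "distr M PT (\<lambda>\<omega> k. T k \<omega>) \<Otimes>\<^sub>M distr M PX (\<lambda>\<omega> k. X k \<omega>) =
      distr M (PT \<Otimes>\<^sub>M PX) (\<lambda>\<omega>. (\<lambda>k. T k \<omega>, \<lambda>k. X k \<omega>))"
proof -
  let ?T = "\<lambda>\<omega> k. T k \<omega>" and ?X = "\<lambda>\<omega> k. X k \<omega>"
  show T[measurable]: "?T \<in> measurable M PT"
    unfolding PT_def
    by (rule measurable_PiM_single') (auto simp: point_measurable dest: measurable_space[OF point_measurable])
  show X[measurable]: "?X \<in> measurable M PX"
    unfolding PX_def by (rule measurable_PiM_single') auto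
  interpret DT: prob_space "distr M PT ?T" by (rule prob_space_distr) measurable
  interpret DX: prob_space "distr M PX ?X" by (rule prob_space_distr) measurable
  show "distr M PT ?T \<Otimes>\<^sub>M distr M PX ?X = distr M (PT \<Otimes>\<^sub>M PX) (\<lambda>\<omega>. (?T \<omega>, ?X \<omega>))"
  proof (rule pair_measure_eqI)
    fix A B assume "A \<in> sets (distr M PT ?T)" "B \<in> sets (distr M PX ?X)"
    then have A[measurable]: "A \<in> sets PT" and B[measurable]: "B \<in> sets PX" by auto
    have "prob ((?T -` A \<inter> space M) \<inter> (?X -` B \<inter> space M)) =
        prob (?T -` A \<inter> space M) * prob (?X -` B \<inter> space M)"
      using A B by (intro indep_setD[OF marks_indep_points] in_vimage_algebra) (auto simp: PT_def PX_def)
    moreover have "(\<lambda>\<omega>. (?T \<omega>, ?X \<omega>)) -` (A \<times> B) \<inter> space M = (?T -` A \<inter> space M) \<inter> (?X -` B \<inter> space M)"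
      by auto
    ultimately show "emeasure (distr M PT ?T) A * emeasure (distr M PX ?X) B =
        emeasure (distr M (PT \<Otimes>\<^sub>M PX) (\<lambda>\<omega>. (?T \<omega>, ?X \<omega>))) (A \<times> B)"
      by (simp add: emeasure_distr emeasure_eq_measure ennreal_mult)
  qed (auto intro: DT.sigma_finite_measure DX.sigma_finite_measure sets_pair_measure_cong DT.sigma_finite_measure_axioms DX.sigma_finite_measure_axioms)
qed

text \<open>The positions \<open>t\<close> are deterministic here, so independence of the marks
  alone gives the product.\<close>

lemma prob_marks_lt:
  "emeasure M {\<omega> \<in> space M. \<forall>k<K. \<not> L2_set (t k) {..<n} \<le> X k \<omega> * sqrt n} =
    ennreal (\<Prod>k<K. 1 - cover_prob (t k))"
\<comment> \<open>For \<open>K = 0\<close> the intersection used below would be \<open>UNIV\<close>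
  instead of \<open>space M\<close>.\<close>
proof (cases "K = 0")
  case True
  then show ?thesis by (simp add: emeasure_space_1)
next
  case False
  interpret P: prob_space mark_law by (rule prob_space_mark_law)
  have "prob {\<omega> \<in> space M. \<forall>k<K. \<not> L2_set (t k) {..<n} \<le> X k \<omega> * sqrt n} =
      prob (\<Inter>k\<in>{..<K}. X k -` {x. \<not> L2_set (t k) {..<n} \<le> x * sqrt n} \<inter> space M)"
    using False by (intro arg_cong[where f=prob]) auto
  also have "\<dots> = (\<Prod>k<K. prob (X k -` {x. \<not> L2_set (t k) {..<n} \<le> x * sqrt n} \<inter> space M))"
    using False by (intro indep_varsD[OF marks_indep]) auto
  also have "\<dots> = (\<Prod>k<K. 1 - cover_prob (t k))"
  proof (intro prod.cong refl)
    fix k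
    have "prob (X k -` {x. \<not> L2_set (t k) {..<n} \<le> x * sqrt n} \<inter> space M) =
        measure mark_law {x. \<not> L2_set (t k) {..<n} \<le> x * sqrt n}"
      unfolding marks_distr[of k, symmetric] by (subst measure_distr) auto
    also have "\<dots> = measure mark_law (space mark_law - {x. L2_set (t k) {..<n} \<le> x * sqrt n})"
      by (intro arg_cong[where f="measure mark_law"]) auto
    also have "\<dots> = 1 - cover_prob (t k)"
      unfolding cover_prob_def by (rule P.prob_compl) simp
    finally show "prob (X k -` {x. \<not> L2_set (t k) {..<n} \<le> x * sqrt n} \<inter> space M) = 1 - cover_prob (t k)" .
  qed
  finally show ?thesis by (simp add: emeasure_eq_measure)
qed

text \<open>Slicing the product law at the realised positions \<open>T k \<omega>\<close> reduces to
  \<open>prob_marks_lt\<close>. The restriction to the first \<open>K\<close> points keeps the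
  product finite until \<open>vacancy_eq\<close> lets \<open>K\<close> grow.\<close>

lemma prob_first_points_miss:
  "emeasure M {\<omega> \<in> space M. \<forall>k<K. \<not> L2_set (T k \<omega>) {..<n} \<le> X k \<omega> * sqrt n} =
    (\<integral>\<^sup>+\<omega>. ennreal (\<Prod>k<K. 1 - cover_prob (T k \<omega>)) \<partial>M)"
proof -
  let ?PT = "PiM UNIV (\<lambda>_::nat. euclid n)" and ?PX = "PiM UNIV (\<lambda>_::nat. borel :: real measure)"
  let ?T = "\<lambda>\<omega> k. T k \<omega>" and ?X = "\<lambda>\<omega> k. X k \<omega>"
  have T[measurable]: "?T \<in> measurable M ?PT" and X[measurable]: "?X \<in> measurable M ?PX"
    and joint: "distr M ?PT ?T \<Otimes>\<^sub>M distr M ?PX ?X = distr M (?PT \<Otimes>\<^sub>M ?PX) (\<lambda>\<omega>. (?T \<omega>, ?X \<omega>))"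
    by (rule joint_law_points_marks)+
  interpret X: prob_space "distr M ?PX ?X" by (rule prob_space_distr) measurable
  define D where "D = {p \<in> space (?PT \<Otimes>\<^sub>M ?PX). \<forall>k<K. \<not> L2_set (fst p k) {..<n} \<le> snd p k * sqrt n}"
  have "Measurable.pred (?PT \<Otimes>\<^sub>M ?PX) (\<lambda>p. \<not> L2_set (fst p k) {..<n} \<le> snd p k * sqrt n)" for k
  proof -
    have [measurable]: "(\<lambda>p. fst p k) \<in> measurable (?PT \<Otimes>\<^sub>M ?PX) (euclid n)"
      by (rule measurable_compose[OF measurable_fst measurable_component_singleton]) simp
    have [measurable]: "(\<lambda>p. snd p k) \<in> measurable (?PT \<Otimes>\<^sub>M ?PX) borel"
      by (rule measurable_compose[OF measurable_snd measurable_component_singleton]) simp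
    show ?thesis by measurable
  qed
  then have D: "D \<in> sets (?PT \<Otimes>\<^sub>M ?PX)" unfolding D_def by measurable
  have "emeasure M {\<omega> \<in> space M. \<forall>k<K. \<not> L2_set (T k \<omega>) {..<n} \<le> X k \<omega> * sqrt n} =
      emeasure (distr M (?PT \<Otimes>\<^sub>M ?PX) (\<lambda>\<omega>. (?T \<omega>, ?X \<omega>))) D"
    using measurable_space[OF T] measurable_space[OF X]
    by (subst emeasure_distr[OF _ D]) (auto simp: D_def space_pair_measure intro!: arg_cong[where f="emeasure M"])
  also have "\<dots> = (\<integral>\<^sup>+t. emeasure (distr M ?PX ?X) (Pair t -` D) \<partial>distr M ?PT ?T)"
    unfolding joint[symmetric] using D by (intro X.emeasure_pair_measure_alt) (simp cong: sets_pair_measure_cong)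
  also have "\<dots> = (\<integral>\<^sup>+\<omega>. emeasure (distr M ?PX ?X) (Pair (?T \<omega>) -` D) \<partial>M)"
    using D by (intro nn_integral_distr X.measurable_emeasure_Pair T) (simp cong: sets_pair_measure_cong)
  also have "\<dots> = (\<integral>\<^sup>+\<omega>. ennreal (\<Prod>k<K. 1 - cover_prob (T k \<omega>)) \<partial>M)"
  proof (rule nn_integral_cong)
    fix \<omega> assume \<omega>: "\<omega> \<in> space M"
    have "emeasure (distr M ?PX ?X) (Pair (?T \<omega>) -` D) =
        emeasure M {\<omega>' \<in> space M. \<forall>k<K. \<not> L2_set (T k \<omega>) {..<n} \<le> X k \<omega>' * sqrt n}"
      using measurable_space[OF T \<omega>] measurable_space[OF X] sets_Pair1[OF D]
      by (subst emeasure_distr) (auto simp: D_def space_pair_measure intro!: arg_cong[where f="emeasure M"])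
    then show "emeasure (distr M ?PX ?X) (Pair (?T \<omega>) -` D) = ennreal (\<Prod>k<K. 1 - cover_prob (T k \<omega>))"
      by (simp add: prob_marks_lt)
  qed
  finally show ?thesis .
qed

text \<open>The events that the first \<open>K\<close> points miss the origin decrease to vacancy.
  Their probabilities are integrals of partial products, so moving the infimum inside the integral
  produces the generating functional at \<open>cover_prob\<close>.\<close>

lemma vacancy_eq:
  assumes v: "(\<integral>\<^sup>+t. ennreal (cover_prob t) \<partial>euclid n) = ennreal v" "v \<ge> 0"
  shows "vacancy M n T X = exp (- (intensity * v))"
    and "volume_fraction M n T X = 1 - exp (- (intensity * v))"
proof -
  note [measurable] = point_measurable
  define V where "V K = {\<omega> \<in> space M. \<forall>k<K. \<not> L2_set (T k \<omega>) {..<n} \<le> X k \<omega> * sqrt n}" for K :: nat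
  have [measurable]: "V K \<in> events" for K unfolding V_def by measurable
  have Veq: "{\<omega> \<in> space M. origin n \<notin> boolean_model n T X \<omega>} = (\<Inter>K. V K)"
    by (auto simp: boolean_model_def origin_in_euclid_cball V_def)
  have "emeasure M (\<Inter>K. V K) = (INF K. emeasure M (V K))"
    by (rule INF_emeasure_decseq[symmetric]) (auto simp: decseq_def V_def)
  also have "\<dots> = (INF K. \<integral>\<^sup>+\<omega>. ennreal (\<Prod>k<K. 1 - cover_prob (T k \<omega>)) \<partial>M)"
    unfolding V_def prob_first_points_miss ..
  also have "\<dots> = (\<integral>\<^sup>+\<omega>. (INF K. ennreal (\<Prod>k<K. 1 - cover_prob (T k \<omega>))) \<partial>M)"
  proof (rule nn_integral_monotone_convergence_INF_AE[symmetric])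
    have "(\<Prod>k<Suc K. 1 - cover_prob (T k \<omega>)) \<le> (\<Prod>k<K. 1 - cover_prob (T k \<omega>))" for K \<omega>
      using cover_prob_bounds by (simp add: mult_left_le prod_nonneg)
    then show "AE \<omega> in M. ennreal (\<Prod>k<Suc K. 1 - cover_prob (T k \<omega>)) \<le> ennreal (\<Prod>k<K. 1 - cover_prob (T k \<omega>))" for K
      by (intro AE_I2 ennreal_leI)
    show "(\<integral>\<^sup>+\<omega>. ennreal (\<Prod>k<0. 1 - cover_prob (T k \<omega>)) \<partial>M) < \<infinity>"
      by (simp add: emeasure_space_1)
  qed measurable
  also have "\<dots> = ennreal (exp (- (intensity * v)))"
    by (rule generating_functional[OF cover_prob_measurable cover_prob_bounds v])
  finally show vac: "vacancy M n T X = exp (- (intensity * v))"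
    by (simp add: vacancy_def Veq measure_def)
  have "{\<omega> \<in> space M. origin n \<in> boolean_model n T X \<omega>} = space M - (\<Inter>K. V K)"
    unfolding Veq[symmetric] by auto
  then show "volume_fraction M n T X = 1 - exp (- (intensity * v))"
    using vac by (simp add: vacancy_def volume_fraction_def Veq prob_compl)
qed

end

section \<open>The volume of the ball of radius square root of the dimension\<close>

text \<open>A Stolz-Cesaro argument with step two, because the recursion for ball volumes links
  dimensions \<open>n\<close> and \<open>n + 2\<close>.\<close>

lemma tendsto_div_of_two_step_difference:
  fixes b :: "nat \<Rightarrow> real"
  assumes "(\<lambda>n. b (n + 2) - b n) \<longlonglongrightarrow> 0"
  shows "(\<lambda>n. b n / real n) \<longlonglongrightarrow> 0"
proof (rule LIMSEQ_I)
  fix e :: real assume e: "e > 0"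
  then obtain N where N: "\<And>n. n \<ge> N \<Longrightarrow> \<bar>b (n + 2) - b n\<bar> < e / 2"
    using LIMSEQ_D[OF assms, of "e / 2"] by auto
  \<comment> \<open>Steps of length two preserve parity, so both \<open>N\<close> and
    \<open>N + 1\<close> are starting values.\<close>
  define C where "C = \<bar>b N\<bar> + \<bar>b (N + 1)\<bar>"
  \<comment> \<open>Slope \<open>e / 2\<close> permits growth \<open>e\<close> over a double step,
    more than the \<open>e / 2\<close> guaranteed by \<open>N\<close>; the other half of
    \<open>e\<close> later absorbs \<open>C\<close>.\<close>
  have bound: "n \<ge> N \<Longrightarrow> \<bar>b n\<bar> \<le> C + e / 2 * n" for n
  proof (induction n rule: less_induct)
    case (less n)
    have pos: "0 \<le> e / 2 * real n" using e by simp
    consider "n = N" | "n = N + 1" | "n \<ge> N + 2" using less.prems by linarith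
    then show ?case
    proof cases
      case 3
      then obtain k where k: "n = k + 2" "k \<ge> N" by (metis add_leD2 le_Suc_ex add.commute add_le_cancel_right)
      then have "\<bar>b k\<bar> \<le> C + e / 2 * k" using less.IH[of k] by simp
      moreover have "\<bar>b n - b k\<bar> < e / 2" using N[OF k(2)] k by simp
      moreover have "e / 2 * real n = e / 2 * real k + e" using k by (simp add: field_simps)
      ultimately show ?thesis using e by linarith
    qed (use pos in \<open>auto simp: C_def\<close>)
  qed
  have "eventually (\<lambda>n. real n > 2 * C / e) sequentially"
    using filterlim_real_sequentially by (simp add: filterlim_at_top_dense)
  then have "eventually (\<lambda>n. \<bar>b n / real n\<bar> < e) sequentially"
    using eventually_ge_at_top[of N] eventually_ge_at_top[of 1]
  proof eventually_elim
    case (elim n)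
    then have "C < e / 2 * n" using e by (simp add: field_simps)
    then have "\<bar>b n\<bar> < e * n" using bound[of n] elim by simp
    then show ?case using elim by (simp add: field_simps)
  qed
  then show "\<exists>no. \<forall>n\<ge>no. norm (b n / real n - 0) < e"
    by (simp add: eventually_sequentially)
qed

text \<open>The functional equation of Gamma. With the two-step limit lemma, this recursion takes
  the place of Stirling's formula.\<close>

lemma unit_ball_vol_plus_2:
  assumes "x \<ge> 0"
  shows "unit_ball_vol (x + 2) = unit_ball_vol x * (2 * pi / (x + 2))"
proof -
  have "Gamma ((x / 2 + 1) + 1) = (x / 2 + 1) * Gamma (x / 2 + 1)"
    using assms by (intro Gamma_plus1) (auto elim!: nonpos_Ints_cases)
  moreover have "(x + 2) / 2 + 1 = (x / 2 + 1) + 1" by simp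
  moreover have "pi powr ((x + 2) / 2) = pi powr (x / 2) * pi"
    by (simp add: add_divide_distrib powr_add)
  ultimately have "unit_ball_vol (x + 2) = (pi powr (x / 2) * pi) / ((x / 2 + 1) * Gamma (x / 2 + 1))"
    by (simp only: unit_ball_vol_def)
  also have "x / 2 + 1 = (x + 2) / 2" by simp
  also have "(pi powr (x / 2) * pi) / ((x + 2) / 2 * Gamma ((x + 2) / 2)) =
      pi powr (x / 2) / Gamma ((x + 2) / 2) * (2 * pi / (x + 2))" by (simp add: mult_ac)
  finally show ?thesis by (simp add: unit_ball_vol_def add_divide_distrib)
qed

lemma ln_ball_volume_rate:
  "(\<lambda>n. ln (unit_ball_vol (real n) * sqrt (real n) ^ n) / real n) \<longlonglongrightarrow> 1/2 * ln (2 * pi * exp 1)"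
proof -
  define L where "L = 1/2 * ln (2 * pi * exp 1)"
  \<comment> \<open>The deviation from linear growth. The slope \<open>L\<close> is forced:
    \<open>2 * L = ln (2 * pi) + 1\<close> is the limit of the two-step increments, where the 1 is
    half the logarithm of the limit \<open>exp 2\<close> of \<open>(1 + 2 / n) ^ n\<close>.\<close>
  define b where "b n = ln (unit_ball_vol (real n) * sqrt (real n) ^ n) - real n * L" for n
  have L: "2 * L = ln (2 * pi) + 1"
    by (simp add: L_def ln_mult)
  have ln_eq: "ln (unit_ball_vol (real n) * sqrt (real n) ^ n) = ln (unit_ball_vol n) + n / 2 * ln n"
    if "n \<ge> 1" for n :: nat
    using that by (simp add: ln_mult ln_realpow ln_sqrt less_imp_neq[OF unit_ball_vol_pos, symmetric])
  have diff: "b (n + 2) - b n = 1/2 * ln ((1 + 2 / real n) ^ n) - 1" if n: "n \<ge> 1" for n :: nat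
  proof -
    have "ln (unit_ball_vol (real (n + 2))) = ln (unit_ball_vol n) + (ln (2 * pi) - ln (real n + 2))"
    proof -
      have "unit_ball_vol (real (n + 2)) = unit_ball_vol n * (2 * pi / (real n + 2))"
        using unit_ball_vol_plus_2[of "real n"] by (simp add: add.commute)
      then show ?thesis
        using n unit_ball_vol_pos[of "real n"] pi_gt_zero by (simp add: ln_mult ln_div del: unit_ball_vol_pos)
    qed
    moreover have "1 + 2 / real n = (real n + 2) / real n" using n by (simp add: field_simps)
    then have "ln ((1 + 2 / real n) ^ n) = n * (ln (real n + 2) - ln n)"
      using n by (simp add: ln_realpow ln_div)
    ultimately show ?thesis
      using n L ln_eq[of n] ln_eq[of "n + 2"] by (simp add: b_def algebra_simps add_divide_distrib)
  qed
  have "(\<lambda>n. 1/2 * ln ((1 + 2 / real n) ^ n) - 1) \<longlonglongrightarrow> 1/2 * ln (exp 2) - 1"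
    by (intro tendsto_intros tendsto_exp_limit_sequentially) simp
  then have "(\<lambda>n. 1/2 * ln ((1 + 2 / real n) ^ n) - 1) \<longlonglongrightarrow> 0" by simp
  then have "(\<lambda>n. b (n + 2) - b n) \<longlonglongrightarrow> 0"
    by (rule Lim_transform_eventually)
      (use diff in \<open>auto intro!: eventually_mono[OF eventually_ge_at_top[of 1]]\<close>)
  then have "(\<lambda>n. b n / real n + L) \<longlonglongrightarrow> 0 + L"
    by (intro tendsto_intros tendsto_div_of_two_step_difference)
  then have "(\<lambda>n. b n / real n + L) \<longlonglongrightarrow> L" by simp
  then show ?thesis
    unfolding L_def[symmetric]
    by (rule Lim_transform_eventually)
      (auto intro!: eventually_mono[OF eventually_ge_at_top[of 1]] simp: b_def field_simps)
qed

section \<open>Large deviations and the growth of the moments\<close>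

lemma exp_minus_mult_tendsto_0:
  fixes c :: real
  assumes "c > 0"
  shows "(\<lambda>n. exp (- (real n * c))) \<longlonglongrightarrow> 0"
proof -
  have "(\<lambda>n. exp (- c) ^ n) \<longlonglongrightarrow> 0" using assms by (intro LIMSEQ_power_zero) simp
  then show ?thesis by (simp add: exp_of_nat_mult[symmetric])
qed

locale ldp_marks =
  fixes Q :: "nat \<Rightarrow> 'b measure" and Y :: "nat \<Rightarrow> 'b \<Rightarrow> real" and I :: "real \<Rightarrow> ereal"
    and Rstar \<gamma> :: real
  assumes prob_space_Q: "\<And>n. n \<ge> 1 \<Longrightarrow> prob_space (Q n)"
    and Y_measurable: "\<And>n. n \<ge> 1 \<Longrightarrow> Y n \<in> borel_measurable (Q n)"
    and Y_nonneg: "\<And>n. n \<ge> 1 \<Longrightarrow> AE \<omega> in Q n. 0 \<le> Y n \<omega>"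
    and Rstar_pos: "0 < Rstar"
    and mean_tendsto: "(\<lambda>n. \<integral>\<^sup>+\<omega>. ennreal (Y n \<omega>) \<partial>Q n) \<longlonglongrightarrow> ennreal Rstar"
    and good: "good_rate_function I"
    and convex: "convex_ereal I"
    and ldp: "large_deviations_principle Q Y I"
    and \<gamma>: "\<gamma> > 1"
    and moment_limsup:
      "limsup (\<lambda>n. ennreal_powr (\<integral>\<^sup>+\<omega>. ennreal (Y n \<omega> powr (\<gamma> * real n)) \<partial>Q n) (1 / real n)) < \<infinity>"
begin

definition moment :: "nat \<Rightarrow> ennreal" where
  "moment n = (\<integral>\<^sup>+\<omega>. ennreal (Y n \<omega> ^ n) \<partial>Q n)"

text \<open>The exponent \<open>j\<close> is kept apart from \<open>n\<close>: the mean needs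
  \<open>j = 1\<close>, the moment \<open>j = n\<close>.\<close>

definition tail_moment :: "nat \<Rightarrow> nat \<Rightarrow> real \<Rightarrow> ennreal" where
  "tail_moment n j K = (\<integral>\<^sup>+\<omega>. ennreal (Y n \<omega> ^ j) * indicator {\<omega>. K < Y n \<omega>} \<omega> \<partial>Q n)"

definition dev :: "nat \<Rightarrow> real set \<Rightarrow> real" where
  "dev n F = measure (Q n) {\<omega> \<in> space (Q n). Y n \<omega> \<in> F}"

section \<open>Exponential bounds from the large deviations principle\<close>

lemma nn_integral_dev:
  assumes "n \<ge> 1" "F \<in> sets borel"
  shows "(\<integral>\<^sup>+\<omega>. ennreal a * indicator {\<omega>. Y n \<omega> \<in> F} \<omega> \<partial>Q n) = ennreal a * ennreal (dev n F)"
proof -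
  interpret P: prob_space "Q n" by (rule prob_space_Q[OF assms(1)])
  note [measurable] = Y_measurable[OF assms(1)] assms(2)
  have "(\<integral>\<^sup>+\<omega>. ennreal a * indicator {\<omega>. Y n \<omega> \<in> F} \<omega> \<partial>Q n) =
      (\<integral>\<^sup>+\<omega>. ennreal a * indicator {\<omega> \<in> space (Q n). Y n \<omega> \<in> F} \<omega> \<partial>Q n)"
    by (intro nn_integral_cong) (auto simp: indicator_def)
  then show ?thesis
    by (simp add: nn_integral_cmult P.emeasure_eq_measure dev_def)
qed

lemma ldp_upper:
  assumes "closed F" "ereal c < (INF x\<in>F. I x)"
  shows "eventually (\<lambda>n. dev n F \<le> exp (- (real n * c))) sequentially"
proof -
  have "limsup (\<lambda>n. ext_ln (ereal (dev n F)) / ereal (real n)) \<le> - (INF x\<in>F. I x)"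
    using ldp assms(1) unfolding large_deviations_principle_def dev_def by blast
  also have "\<dots> < ereal (- c)" using assms(2) by (simp add: ereal_uminus_less_reorder)
  finally have "eventually (\<lambda>n. ext_ln (ereal (dev n F)) / ereal (real n) < ereal (- c)) sequentially"
    by (rule Limsup_lessD)
  then show ?thesis using eventually_ge_at_top[of 1]
  proof eventually_elim
    case (elim n)
    show ?case
    proof (cases "dev n F \<le> 0")
      \<comment> \<open>Probability zero, where \<open>ext_ln\<close> is minus infinity, satisfies
        every exponential upper bound.\<close>
      case True
      then show ?thesis by (meson exp_ge_zero order_trans)
    next
      case False
      then have "ln (dev n F) / n < - c" using elim by (simp add: ext_ln_def)
      then have "ln (dev n F) < - (n * c)" using elim by (simp add: field_simps)
      then have "dev n F < exp (- (n * c))" using False by (metis exp_less_mono exp_ln not_le)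
      then show ?thesis by simp
    qed
  qed
qed

lemma ldp_lower:
  assumes "open G" "(INF x\<in>G. I x) < ereal c"
  shows "eventually (\<lambda>n. exp (- (real n * c)) \<le> dev n G) sequentially"
proof -
  have "ereal (- c) < - (INF x\<in>G. I x)" using assms(2) unfolding uminus_ereal.simps(1)[symmetric] ereal_minus_less_minus by simp
  also have "\<dots> \<le> liminf (\<lambda>n. ext_ln (ereal (dev n G)) / ereal (real n))"
    using ldp assms(1) unfolding large_deviations_principle_def dev_def by blast
  finally have "eventually (\<lambda>n. ereal (- c) < ext_ln (ereal (dev n G)) / ereal (real n)) sequentially"
    by (rule less_LiminfD)
  then show ?thesis using eventually_ge_at_top[of 1]
  proof eventually_elim
    case (elim n)
    \<comment> \<open>A value above the finite number \<open>- c\<close> excludes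
      \<open>ext_ln 0\<close>, so the probability is positive.\<close>
    then have pos: "dev n G > 0" by (auto simp: ext_ln_def split: if_splits)
    then have "- c < ln (dev n G) / n" using elim by (simp add: ext_ln_def)
    then have "- (n * c) < ln (dev n G)" using elim by (simp add: field_simps)
    then have "exp (- (n * c)) < dev n G" using pos by (metis exp_less_mono exp_ln)
    then show ?case by simp
  qed
qed

section \<open>Tails of the moments\<close>

lemma eventually_moment_bound:
  "\<exists>C\<ge>1. eventually (\<lambda>n. (\<integral>\<^sup>+\<omega>. ennreal (Y n \<omega> powr (\<gamma> * real n)) \<partial>Q n) \<le> ennreal (C ^ n)) sequentially"
proof -
  define m where "m n = (\<integral>\<^sup>+\<omega>. ennreal (Y n \<omega> powr (\<gamma> * real n)) \<partial>Q n)" for n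
  obtain B where B: "limsup (\<lambda>n. ennreal_powr (m n) (1 / real n)) < B" "B < \<infinity>"
    using moment_limsup dense unfolding m_def by blast
  \<comment> \<open>The maximum with 1 makes \<open>C\<close> positive, so that
    \<open>C powr n\<close> is \<open>C ^ n\<close>.\<close>
  define C where "C = max 1 (enn2real B)"
  have BC: "B \<le> ennreal C"
  proof -
    have "B = ennreal (enn2real B)" using B(2) by simp
    also have "\<dots> \<le> ennreal C" unfolding C_def by (intro ennreal_leI) simp
    finally show ?thesis .
  qed
  have "eventually (\<lambda>n. ennreal_powr (m n) (1 / real n) < B) sequentially"
    by (rule Limsup_lessD[OF B(1)])
  then have "eventually (\<lambda>n. m n \<le> ennreal (C ^ n)) sequentially"
    using eventually_ge_at_top[of 1]
  proof eventually_elim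
    case (elim n)
    have fin: "m n \<noteq> \<top>" using elim B(2) by (auto simp: ennreal_powr_def)
    have "ennreal (enn2real (m n) powr (1 / n)) < ennreal C"
      using elim fin BC by (simp add: ennreal_powr_def)
    then have *: "enn2real (m n) powr (1 / n) \<le> C"
      by (subst (asm) ennreal_less_iff) auto
    have "enn2real (m n) = (enn2real (m n) powr (1 / n)) powr n"
      using elim by (simp add: powr_powr)
    also have "\<dots> \<le> C powr n" using * by (intro powr_mono2) auto
    also have "\<dots> = C ^ n" by (simp add: powr_realpow C_def)
    finally have "ennreal (enn2real (m n)) \<le> ennreal (C ^ n)" by (rule ennreal_leI)
    then show ?case using fin by (simp add: less_top)
  qed
  then show ?thesis unfolding m_def by (intro exI[of _ C]) (simp add: C_def)
qed

text \<open>For \<open>y > K \<ge> 1\<close> and \<open>j \<le> n\<close>, \<open>y ^ j\<close> is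
  at most \<open>y ^ n\<close>, and trading the power \<open>\<gamma> * n\<close> for
  \<open>n\<close> gains a factor \<open>K powr (n * (1 - \<gamma>))\<close>. The tail is therefore
  at most \<open>(C * K powr (1 - \<gamma>)) ^ n\<close>, whose base tends to 0 as \<open>K\<close>
  grows because \<open>\<gamma> > 1\<close>.\<close>

lemma tail_moment_small:
  assumes \<epsilon>: "\<epsilon> > 0"
  shows "\<exists>K0\<ge>1. \<forall>K\<ge>K0. eventually (\<lambda>n. \<forall>j\<le>n. tail_moment n j K \<le> ennreal (\<epsilon> ^ n)) sequentially"
proof -
  obtain C where C: "C \<ge> 1"
    "eventually (\<lambda>n. (\<integral>\<^sup>+\<omega>. ennreal (Y n \<omega> powr (\<gamma> * real n)) \<partial>Q n) \<le> ennreal (C ^ n)) sequentially"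
    using eventually_moment_bound by auto
  have "((\<lambda>K. C * K powr (1 - \<gamma>)) \<longlongrightarrow> C * 0) at_top"
    using \<gamma> by (intro tendsto_intros tendsto_neg_powr filterlim_ident) auto
  then have "eventually (\<lambda>K. C * K powr (1 - \<gamma>) < \<epsilon>) at_top"
    using \<epsilon> by (auto dest: order_tendstoD)
  then obtain K0 where K0: "\<And>K. K \<ge> K0 \<Longrightarrow> C * K powr (1 - \<gamma>) < \<epsilon>"
    by (auto simp: eventually_at_top_linorder)
  show ?thesis
  proof (intro exI[of _ "max 1 K0"] conjI allI impI)
    fix K assume K: "max 1 K0 \<le> K"
    show "eventually (\<lambda>n. \<forall>j\<le>n. tail_moment n j K \<le> ennreal (\<epsilon> ^ n)) sequentially"
      using C(2) eventually_ge_at_top[of 1]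
    proof eventually_elim
      case (elim n)
      note [measurable] = Y_measurable[OF elim(2)]
      show ?case
      proof (intro allI impI)
        fix j assume j: "j \<le> n"
        have pt: "y ^ j \<le> K powr (n * (1 - \<gamma>)) * y powr (\<gamma> * n)" if y: "K < y" for y
        proof -
          have "y ^ j \<le> y ^ n" using y K j by (intro power_increasing) auto
          also have "y ^ n = y powr (n * (1 - \<gamma>)) * y powr (\<gamma> * n)"
            using y K by (simp add: powr_add[symmetric] powr_realpow[symmetric] algebra_simps)
          also have "\<dots> \<le> K powr (n * (1 - \<gamma>)) * y powr (\<gamma> * n)"
            using y K \<gamma> by (intro mult_right_mono powr_mono2') (auto simp: mult_nonneg_nonpos)
          finally show ?thesis .
        qed
        have "tail_moment n j K \<le>
            (\<integral>\<^sup>+\<omega>. ennreal (K powr (n * (1 - \<gamma>))) * ennreal (Y n \<omega> powr (\<gamma> * n)) \<partial>Q n)"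
          unfolding tail_moment_def
          by (intro nn_integral_mono) (auto simp: indicator_def ennreal_mult'[symmetric] intro!: ennreal_leI pt)
        also have "\<dots> = ennreal (K powr (n * (1 - \<gamma>))) * (\<integral>\<^sup>+\<omega>. ennreal (Y n \<omega> powr (\<gamma> * n)) \<partial>Q n)"
          by (rule nn_integral_cmult) measurable
        also have "\<dots> \<le> ennreal (K powr (n * (1 - \<gamma>))) * ennreal (C ^ n)"
          using elim by (intro mult_left_mono) auto
        also have "\<dots> = ennreal ((C * K powr (1 - \<gamma>)) ^ n)"
          using C(1) K by (simp add: ennreal_mult'[symmetric] power_mult_distrib powr_realpow[symmetric] powr_powr mult_ac)
        also have "\<dots> \<le> ennreal (\<epsilon> ^ n)"
          using C(1) K0[of K] K by (intro ennreal_leI power_mono) auto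
        finally show "tail_moment n j K \<le> ennreal (\<epsilon> ^ n)" .
      qed
    qed
  qed simp
qed

section \<open>The zero of the rate function at the limiting mean\<close>

lemma I_nonneg: "0 \<le> I x"
  using good by (simp add: good_rate_function_def)

text \<open>The upper bound applied to the closed set \<open>UNIV\<close>, whose probability is 1
  and whose logarithm is 0.\<close>

lemma INF_I: "(INF x. I x) = 0"
proof (rule antisym)
  have "eventually (\<lambda>n. ext_ln (ereal (dev n UNIV)) / ereal (real n) = 0) sequentially"
    using eventually_ge_at_top[of 1]
  proof eventually_elim
    case (elim n)
    have "dev n UNIV = 1" using prob_space.prob_space[OF prob_space_Q[OF elim]] by (simp add: dev_def)
    then show ?case using elim by (simp add: ext_ln_def zero_ereal_def)
  qed
  then have "limsup (\<lambda>n. ext_ln (ereal (dev n UNIV)) / ereal (real n)) = 0"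
    by (subst Limsup_eq[where g="\<lambda>_. 0"]) (auto simp: Limsup_const)
  moreover have "limsup (\<lambda>n. ext_ln (ereal (dev n UNIV)) / ereal (real n)) \<le> - (INF x. I x)"
    using ldp unfolding large_deviations_principle_def dev_def by blast
  ultimately show "(INF x. I x) \<le> 0" by (simp add: ereal_uminus_le_reorder)
qed (auto intro: INF_greatest I_nonneg)

text \<open>Sublevel sets of a convex function are intervals; convexity enters
  \<open>I_Rstar\<close> in this form.\<close>

lemma convex_between_le:
  assumes "I a \<le> ereal c" "I b \<le> ereal c" "a \<le> x" "x \<le> b"
  shows "I x \<le> ereal c"
proof (cases "a = b")
  case False
  then have ab: "a < b" using assms by simp
  define t where "t = (x - a) / (b - a)"
  have t: "0 \<le> t" "t \<le> 1" using assms ab by (auto simp: t_def)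
  have "t * (b - a) = x - a" using ab by (simp add: t_def)
  then have "x = (1 - t) * a + t * b" by (simp add: algebra_simps)
  then have "I x \<le> ereal (1 - t) * I a + ereal t * I b"
    using convex t unfolding convex_ereal_def by blast
  also have "\<dots> \<le> ereal (1 - t) * ereal c + ereal t * ereal c"
    using t assms by (intro add_mono ereal_mult_left_mono) auto
  also have "\<dots> = ereal c" by (simp add: algebra_simps)
  finally show ?thesis .
qed (use assms in auto)

text \<open>If \<open>I Rstar > 0\<close>, convexity puts all near-minimisers of \<open>I\<close> strictly on one side of \<open>Rstar\<close>,
  and the mean would stay away from \<open>Rstar\<close> on that side.\<close>
lemma I_Rstar: "I Rstar = 0"
proof (rule ccontr)
  assume "I Rstar \<noteq> 0"
  then have "0 < I Rstar" using I_nonneg[of Rstar] by simp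
  then obtain c where c: "0 < ereal c" "ereal c < I Rstar"
    using ereal_dense2 by blast
  have "I Rstar \<le> Liminf (at Rstar) I" using good by (simp add: good_rate_function_def)
  then have "eventually (\<lambda>x. ereal c < I x) (at Rstar)"
    using c(2) by (intro less_LiminfD) (rule less_le_trans)
  then obtain d where d: "d > 0" "\<And>x. x \<noteq> Rstar \<Longrightarrow> \<bar>x - Rstar\<bar> < d \<Longrightarrow> ereal c < I x"
    by (auto simp: eventually_at dist_real_def)
  \<comment> \<open>\<open>d / 2\<close> stays inside the neighbourhood given by lower
    semicontinuity; \<open>Rstar / 2\<close> keeps \<open>Rstar - \<delta>\<close> positive.\<close>
  define \<delta> where "\<delta> = min (d / 2) (Rstar / 2)"
  have \<delta>: "0 < \<delta>" "\<delta> < Rstar" using d(1) Rstar_pos by (auto simp: \<delta>_def)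
  have near: "ereal c < I x" if "\<bar>x - Rstar\<bar> \<le> \<delta>" for x
    using d c(2) that by (cases "x = Rstar") (auto simp: \<delta>_def)
  have "(INF x. I x) < ereal c" using c(1) by (simp add: INF_I)
  \<comment> \<open>The side of \<open>Rstar\<close> on which \<open>x0\<close> lies decides the
    case: a point beyond \<open>Rstar\<close> on the opposite side with \<open>I \<le> c\<close>
    would force \<open>I Rstar \<le> c\<close>.\<close>
  then obtain x0 where x0: "I x0 < ereal c" by (auto simp: INF_less_iff)
  then have x0_ne: "x0 \<noteq> Rstar" using c(2) by auto
  have c2: "ereal (c / 2) < ereal c" "c > 0" using c(1) by auto
  show False
  proof (cases "Rstar < x0")
    case True
    have far: "ereal c < I x" if "x \<le> Rstar + \<delta>" for x
    proof (cases "x \<ge> Rstar")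
      case False
      show ?thesis
      proof (rule ccontr)
        assume "\<not> ereal c < I x"
        then have "I Rstar \<le> ereal c"
          using convex_between_le[of x c x0 Rstar] x0 True False by auto
        then show False using c(2) by simp
      qed
    qed (use near that in auto)
    define a where "a = Rstar + \<delta>"
    have a: "a > 0" using \<delta> Rstar_pos by (simp add: a_def)
    \<comment> \<open>The infimum is at least \<open>c\<close>, but \<open>ldp_upper\<close> needs a
      strict inequality; hence \<open>c / 2\<close>.\<close>
    have "ereal (c / 2) < (INF x\<in>{..a}. I x)"
      using far c2 by (intro less_le_trans[OF c2(1)] INF_greatest) (auto simp: a_def intro: less_imp_le)
    then have "eventually (\<lambda>n. dev n {..a} \<le> exp (- (real n * (c / 2)))) sequentially"
      by (intro ldp_upper) auto
    \<comment> \<open>Markov's inequality: almost all mass lies above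
      \<open>a = Rstar + \<delta>\<close>, so the limiting mean would be at least
      \<open>a\<close>.\<close>
    then have "eventually (\<lambda>n. ennreal (a * (1 - exp (- (real n * (c / 2))))) \<le> (\<integral>\<^sup>+\<omega>. ennreal (Y n \<omega>) \<partial>Q n)) sequentially"
      using eventually_ge_at_top[of 1]
    proof eventually_elim
      case (elim n)
      interpret P: prob_space "Q n" by (rule prob_space_Q[OF elim(2)])
      note [measurable] = Y_measurable[OF elim(2)]
      have "dev n {a<..} = 1 - dev n {..a}"
      proof -
        have "{\<omega> \<in> space (Q n). Y n \<omega> \<in> {a<..}} = space (Q n) - {\<omega> \<in> space (Q n). Y n \<omega> \<in> {..a}}" by auto
        then show ?thesis unfolding dev_def by (simp add: P.prob_compl)
      qed
      then have "ennreal (a * (1 - exp (- (real n * (c / 2))))) \<le> ennreal (a * dev n {a<..})"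
        using elim a by (intro ennreal_leI mult_left_mono) auto
      also have "\<dots> = (\<integral>\<^sup>+\<omega>. ennreal a * indicator {\<omega>. Y n \<omega> \<in> {a<..}} \<omega> \<partial>Q n)"
        using a elim(2) by (subst nn_integral_dev) (auto simp: ennreal_mult dev_def)
      also have "\<dots> \<le> (\<integral>\<^sup>+\<omega>. ennreal (Y n \<omega>) \<partial>Q n)"
        by (intro nn_integral_mono) (auto simp: indicator_def intro!: ennreal_leI)
      finally show ?case .
    qed
    moreover have "(\<lambda>n. a * (1 - exp (- (real n * (c / 2))))) \<longlonglongrightarrow> a * (1 - 0)"
      using c2 by (intro tendsto_intros exp_minus_mult_tendsto_0) auto
    ultimately have "ennreal (a * (1 - 0)) \<le> ennreal Rstar"
      by (intro tendsto_le[OF _ mean_tendsto tendsto_ennrealI]) auto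
    then show False using \<delta> Rstar_pos by (simp add: a_def)
  next
    case False
    then have less: "x0 < Rstar" using x0_ne by simp
    have far: "ereal c < I x" if "Rstar - \<delta> \<le> x" for x
    proof (cases "x \<le> Rstar")
      case False
      show ?thesis
      proof (rule ccontr)
        assume "\<not> ereal c < I x"
        then have "I Rstar \<le> ereal c"
          using convex_between_le[of x0 c x Rstar] x0 less False by auto
        then show False using c(2) by simp
      qed
    qed (use near that in auto)
    define a where "a = Rstar - \<delta>"
    have a: "a > 0" "a < Rstar" using \<delta> by (auto simp: a_def)
    have "ereal (c / 2) < (INF x\<in>{a..}. I x)"
      using far c2 by (intro less_le_trans[OF c2(1)] INF_greatest) (auto simp: a_def intro: less_imp_le)
    then have dev: "eventually (\<lambda>n. dev n {a..} \<le> exp (- (real n * (c / 2)))) sequentially"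
      by (intro ldp_upper) auto
    \<comment> \<open>A small probability of \<open>Y n \<ge> a\<close> does not by itself bound the
      mean. It is split at \<open>a\<close> and \<open>K\<close>: at most \<open>a\<close>, plus
      \<open>K\<close> times that probability, plus a tail with exponent
      \<open>j = 1\<close>.\<close>
    obtain K where K: "K \<ge> 1" "eventually (\<lambda>n. \<forall>j\<le>n. tail_moment n j K \<le> ennreal ((1/2) ^ n)) sequentially"
      using tail_moment_small[of "1/2"] by auto
    have "eventually (\<lambda>n. (\<integral>\<^sup>+\<omega>. ennreal (Y n \<omega>) \<partial>Q n) \<le>
        ennreal (a + K * exp (- (real n * (c / 2))) + (1/2) ^ n)) sequentially"
      using dev K(2) eventually_ge_at_top[of 1]
    proof eventually_elim
      case (elim n)
      interpret P: prob_space "Q n" by (rule prob_space_Q[OF elim(3)])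
      note [measurable] = Y_measurable[OF elim(3)]
      have "(\<integral>\<^sup>+\<omega>. ennreal (Y n \<omega>) \<partial>Q n) \<le> (\<integral>\<^sup>+\<omega>. ennreal a + ennreal K * indicator {\<omega>. Y n \<omega> \<in> {a..}} \<omega> +
          ennreal (Y n \<omega> ^ 1) * indicator {\<omega>. K < Y n \<omega>} \<omega> \<partial>Q n)"
        using a K(1) by (intro nn_integral_mono)
          (auto simp: indicator_def ennreal_plus[symmetric] simp del: ennreal_plus intro!: ennreal_leI add_increasing add_increasing2)
      also have "\<dots> = ennreal a + ennreal K * ennreal (dev n {a..}) + tail_moment n 1 K"
        using nn_integral_dev[OF elim(3), of "{a..}" K]
        by (simp add: nn_integral_add tail_moment_def P.emeasure_space_1)
      also have "\<dots> \<le> ennreal a + ennreal K * ennreal (exp (- (real n * (c / 2)))) + ennreal ((1/2) ^ n)"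
        using elim by (intro add_mono mult_left_mono ennreal_leI) auto
      also have "\<dots> = ennreal (a + K * exp (- (real n * (c / 2))) + (1/2) ^ n)"
        using a K(1) by (simp add: ennreal_mult'[symmetric] ennreal_plus[symmetric] del: ennreal_plus)
      finally show ?case .
    qed
    moreover have "(\<lambda>n. a + K * exp (- (real n * (c / 2))) + (1/2) ^ n) \<longlonglongrightarrow> a + K * 0 + 0"
      using c2 by (intro tendsto_intros exp_minus_mult_tendsto_0 LIMSEQ_power_zero) auto
    ultimately have "ennreal Rstar \<le> ennreal (a + K * 0 + 0)"
      by (intro tendsto_le[OF _ tendsto_ennrealI mean_tendsto]) auto
    then show False using a by (simp add: ennreal_le_iff2)
  qed
qed

section \<open>Exponential growth of the moments\<close>

lemma moment_lower:
  assumes R: "R > 0" "I R < ereal c" and d: "d < ln R - c"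
  shows "eventually (\<lambda>n. ennreal (exp (real n * d)) \<le> moment n) sequentially"
proof -
  \<comment> \<open>Chosen so that \<open>r ^ n * exp (- (n * c)) = exp (n * d)\<close>; the bound
    on \<open>d\<close> says \<open>r < R\<close>, so \<open>R\<close> lies in the open set
    \<open>{r<..}\<close>.\<close>
  define r where "r = exp (d + c)"
  have r: "r > 0" "r < R" using R(1) d by (auto simp: r_def) (metis exp_less_mono exp_ln less_diff_eq)
  have "(INF x\<in>{r<..}. I x) < ereal c" using R r by (intro le_less_trans[OF INF_lower[of R]]) auto
  then have "eventually (\<lambda>n. exp (- (real n * c)) \<le> dev n {r<..}) sequentially"
    by (intro ldp_lower) auto
  then show ?thesis using eventually_ge_at_top[of 1]
  proof eventually_elim
    case (elim n)
    have "exp (real n * d) = r ^ n * exp (- (real n * c))"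
      by (simp add: r_def exp_of_nat_mult[symmetric] exp_add[symmetric] algebra_simps)
    also have "\<dots> \<le> r ^ n * dev n {r<..}" using elim r by (intro mult_left_mono) auto
    finally have "ennreal (exp (real n * d)) \<le> ennreal (r ^ n) * ennreal (dev n {r<..})"
      using r by (subst ennreal_mult[symmetric]) (auto simp: dev_def intro!: ennreal_leI)
    also have "\<dots> = (\<integral>\<^sup>+\<omega>. ennreal (r ^ n) * indicator {\<omega>. Y n \<omega> \<in> {r<..}} \<omega> \<partial>Q n)"
      using elim by (subst nn_integral_dev) auto
    also have "\<dots> \<le> moment n"
      unfolding moment_def using r
      by (intro nn_integral_mono) (auto simp: indicator_def intro!: ennreal_leI power_mono)
    finally show ?case .
  qed
qed

text \<open>The majorant \<open>g\<close> is left open: a constant gives the crude bound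
  \<open>moment_bounded\<close>, a sum over a grid the sharp bound
  \<open>moment_upper\<close>.\<close>

lemma moment_le_trunc_add_tail:
  assumes n: "n \<ge> 1" and g: "g \<in> borel_measurable borel" "\<And>y. 0 \<le> y \<Longrightarrow> y \<le> K \<Longrightarrow> ennreal (y ^ n) \<le> g y"
  shows "moment n \<le> (\<integral>\<^sup>+\<omega>. g (Y n \<omega>) \<partial>Q n) + tail_moment n n K"
proof -
  note [measurable] = Y_measurable[OF n] g(1)
  have "moment n \<le> (\<integral>\<^sup>+\<omega>. g (Y n \<omega>) + ennreal (Y n \<omega> ^ n) * indicator {\<omega>. K < Y n \<omega>} \<omega> \<partial>Q n)"
    unfolding moment_def using Y_nonneg[OF n]
    by (intro nn_integral_mono_AE, eventually_elim) (auto simp: indicator_def add_increasing intro: g(2))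
  then show ?thesis
    unfolding tail_moment_def by (subst (asm) nn_integral_add) measurable
qed

text \<open>A crude bound, whose purpose is to keep the infimum in \<open>INF_rate_finite\<close>
  above minus infinity.\<close>

lemma moment_bounded: "\<exists>B. eventually (\<lambda>n. moment n \<le> ennreal (exp (real n * B))) sequentially"
proof -
  obtain K where K: "K \<ge> 1" "eventually (\<lambda>n. \<forall>j\<le>n. tail_moment n j K \<le> ennreal (1 ^ n)) sequentially"
    using tail_moment_small[of 1] by auto
  \<comment> \<open>The factor 2 absorbs the tail:
    \<open>K ^ n + 1 \<le> (2 * K) ^ n\<close>.\<close>
  have "eventually (\<lambda>n. moment n \<le> ennreal (exp (real n * ln (2 * K)))) sequentially"
    using K(2) eventually_ge_at_top[of 1]
  proof eventually_elim
    case (elim n)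
    interpret P: prob_space "Q n" by (rule prob_space_Q[OF elim(2)])
    have "moment n \<le> (\<integral>\<^sup>+\<omega>. ennreal (K ^ n) \<partial>Q n) + tail_moment n n K"
      by (rule moment_le_trunc_add_tail[OF elim(2)]) (auto intro!: ennreal_leI power_mono)
    also have "\<dots> \<le> ennreal (K ^ n) + ennreal 1"
      using elim by (intro add_mono) (auto simp: P.emeasure_space_1)
    also have "\<dots> \<le> ennreal ((2 * K) ^ n)"
    proof -
      have "(2::real) \<le> 2 ^ n" using elim(2) self_le_power[of "2::real" n] by simp
      moreover have "1 \<le> K ^ n" using K(1) by simp
      moreover have "2 * K ^ n \<le> 2 ^ n * K ^ n"
        using K(1) \<open>2 \<le> 2 ^ n\<close> by (intro mult_right_mono) auto
      ultimately have "K ^ n + 1 \<le> 2 ^ n * K ^ n" by linarith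
      then have "ennreal (K ^ n + 1) \<le> ennreal ((2 * K) ^ n)"
        by (intro ennreal_leI) (simp add: power_mult_distrib)
      then show ?thesis using K(1) by simp
    qed
    also have "(2 * K) ^ n = exp (real n * ln (2 * K))" using K(1) by (simp add: exp_of_nat_mult)
    finally show ?case .
  qed
  then show ?thesis ..
qed

text \<open>A radius with \<open>I R - ln R < - B\<close> would, by \<open>moment_lower\<close>,
  make the moments outgrow \<open>exp (n * B)\<close>. From above, the radius \<open>Rstar\<close>
  gives the finite value \<open>- ln Rstar\<close>. The sign makes \<open>s\<close> the growth rate
  of the moments.\<close>

lemma INF_rate_finite: "\<exists>s. ereal (- s) = (INF R\<in>{Rstar..}. I R - ereal (ln R))"
proof -
  obtain B where B: "eventually (\<lambda>n. moment n \<le> ennreal (exp (real n * B))) sequentially"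
    using moment_bounded ..
  have "ereal (- B) \<le> I R - ereal (ln R)" if R: "R > 0" for R
  proof (rule ccontr)
    assume "\<not> ereal (- B) \<le> I R - ereal (ln R)"
    then have "I R < ereal (ln R - B)"
      using I_nonneg[of R] by (cases "I R") auto
    then obtain c where c: "I R < ereal c" "ereal c < ereal (ln R - B)"
      using ereal_dense2 by blast
    then have "B < ln R - c" by simp
    then obtain d where d: "B < d" "d < ln R - c" using dense by blast
    have "eventually (\<lambda>n. ennreal (exp (real n * d)) \<le> ennreal (exp (real n * B)) \<and> n \<ge> 1) sequentially"
      using moment_lower[OF R c(1) d(2)] B eventually_ge_at_top[of 1]
    proof eventually_elim
      case (elim n)
      show ?case using order_trans[OF elim(1,2)] elim(3) by (rule conjI)
    qed
    then obtain n where "ennreal (exp (real n * d)) \<le> ennreal (exp (real n * B))" "n \<ge> 1"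
      using eventually_happens'[OF sequentially_bot] by blast
    then have "exp (real n * d) \<le> exp (real n * B)" by (subst (asm) ennreal_le_iff) auto
    then show False using d \<open>n \<ge> 1\<close> by simp
  qed
  then have "ereal (- B) \<le> (INF R\<in>{Rstar..}. I R - ereal (ln R))"
    using Rstar_pos by (intro INF_greatest) auto
  moreover have "(INF R\<in>{Rstar..}. I R - ereal (ln R)) \<le> I Rstar - ereal (ln Rstar)"
    by (rule INF_lower) simp
  ultimately have "\<bar>INF R\<in>{Rstar..}. I R - ereal (ln R)\<bar> \<noteq> \<infinity>"
    by (auto simp: I_Rstar)
  then obtain w where "(INF R\<in>{Rstar..}. I R - ereal (ln R)) = ereal w" by auto
  then show ?thesis by (intro exI[of _ "- w"]) simp
qed

text \<open>Half-lines replace the cells of the grid, so that the large deviations upper bound,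
  which is for closed sets, applies. The cell containing \<open>y\<close> already dominates
  \<open>y ^ n\<close>, and the other summands are nonnegative.\<close>

lemma power_le_grid_sum:
  assumes "\<eta> > 0" "0 \<le> y" "y \<le> Rstar * exp (\<eta> * real m)"
  shows "y ^ n \<le> Rstar ^ n +
    (\<Sum>i<m. (Rstar * exp (\<eta> * real (Suc i))) ^ n * indicator {Rstar * exp (\<eta> * real i)..} y)"
  using assms(3)
proof (induction m)
  case 0
  then show ?case using assms(2) by (simp add: power_mono)
next
  case (Suc m)
  let ?S = "\<Sum>i<m. (Rstar * exp (\<eta> * real (Suc i))) ^ n * indicator {Rstar * exp (\<eta> * real i)..} y"
  have S: "0 \<le> ?S" using Rstar_pos by (intro sum_nonneg) auto
  show ?case
  proof (cases "y \<le> Rstar * exp (\<eta> * real m)")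
    case True
    have "0 \<le> (Rstar * exp (\<eta> * real (Suc m))) ^ n * indicator {Rstar * exp (\<eta> * real m)..} y"
      using Rstar_pos by simp
    then show ?thesis using Suc.IH[OF True] by simp
  next
    case False
    have "y ^ n \<le> (Rstar * exp (\<eta> * real (Suc m))) ^ n"
      using Suc.prems assms(2) by (intro power_mono)
    moreover have "0 \<le> Rstar ^ n" using Rstar_pos by simp
    ultimately show ?thesis using S False by simp
  qed
qed

lemma moment_upper:
  assumes s: "ereal (- s) = (INF R\<in>{Rstar..}. I R - ereal (ln R))" and e: "e > s"
  shows "eventually (\<lambda>n. moment n \<le> ennreal (exp (real n * e))) sequentially"
proof -
  \<comment> \<open>Four losses of \<open>\<eta>\<close>: one for the grid ratio, one for the strict
    inequality in \<open>ldp_upper\<close>, and two for the number \<open>m + 2\<close> of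
    summands.\<close>
  define \<eta> where "\<eta> = (e - s) / 4"
  have \<eta>: "\<eta> > 0" using e by (simp add: \<eta>_def)
  have I_ge: "ereal (ln x - s) \<le> I x" if "x \<ge> Rstar" for x
  proof -
    have "ereal (- s) \<le> I x - ereal (ln x)" unfolding s using that by (intro INF_lower) auto
    then show ?thesis using I_nonneg[of x] by (cases "I x") auto
  qed
  \<comment> \<open>Since \<open>I Rstar = 0\<close>, the contribution \<open>Rstar ^ n\<close> of
    the radii below \<open>Rstar\<close> does not exceed the rate \<open>s\<close>.\<close>
  have Rs: "ln Rstar \<le> s" using I_ge[of Rstar] by (simp add: I_Rstar zero_ereal_def)
  obtain K0 where K0: "K0 \<ge> 1"
    "\<And>K. K \<ge> K0 \<Longrightarrow> eventually (\<lambda>n. \<forall>j\<le>n. tail_moment n j K \<le> ennreal (exp s ^ n)) sequentially"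
    using tail_moment_small[of "exp s"] by auto
  define R where "R i = Rstar * exp (\<eta> * real i)" for i :: nat
  have R_pos: "R i > 0" for i using Rstar_pos by (simp add: R_def)
  have R_ge: "R i \<ge> Rstar" for i using Rstar_pos \<eta> by (simp add: R_def)
  have ln_R: "ln (R (Suc i)) = ln (R i) + \<eta>" for i
    using Rstar_pos by (simp add: R_def ln_mult algebra_simps)
  \<comment> \<open>The cut-off for the tail is placed at a grid point, so that the grid covers
    everything up to it.\<close>
  obtain m :: nat where m: "R m \<ge> K0"
  proof -
    obtain m :: nat where "real m \<ge> (ln K0 - ln Rstar) / \<eta>" using real_arch_simple by blast
    then have "\<eta> * m \<ge> ln K0 - ln Rstar" using \<eta> by (simp add: field_simps)
    then have "ln K0 \<le> ln (R m)" using Rstar_pos by (simp add: R_def ln_mult)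
    then show ?thesis using that[of m] K0(1) R_pos[of m] by (simp add: ln_le_cancel_iff)
  qed
  \<comment> \<open>On \<open>{R i..}\<close> the rate function is at least
    \<open>ln (R i) - s\<close>, because \<open>ln\<close> increases. Multiplied by
    \<open>R (Suc i) ^ n\<close>, the logarithms of \<open>R i\<close> cancel and the exponent
    \<open>s + 2 * \<eta>\<close> no longer depends on \<open>i\<close>.\<close>
  have dev_R: "eventually (\<lambda>n. dev n {R i..} \<le> exp (- (real n * (ln (R i) - s - \<eta>)))) sequentially" for i
  proof (rule ldp_upper)
    have "ereal (ln (R i) - s - \<eta>) < ereal (ln (R i) - s)" using \<eta> by simp
    also have "\<dots> \<le> (INF x\<in>{R i..}. I x)"
    proof (rule INF_greatest)
      fix x assume x: "x \<in> {R i..}"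
      have "ereal (ln (R i) - s) \<le> ereal (ln x - s)" using x R_pos[of i] by simp
      also have "\<dots> \<le> I x" using x R_ge[of i] by (intro I_ge) simp
      finally show "ereal (ln (R i) - s) \<le> I x" .
    qed
    finally show "ereal (ln (R i) - s - \<eta>) < (INF x\<in>{R i..}. I x)" .
  qed simp
  have "filterlim (\<lambda>n. exp (2 * \<eta> * real n)) at_top sequentially"
    using \<eta> by (intro filterlim_compose[OF exp_at_top] filterlim_tendsto_pos_mult_at_top[OF tendsto_const _ filterlim_real_sequentially]) auto
  then have big: "eventually (\<lambda>n. real m + 2 \<le> exp (2 * \<eta> * real n)) sequentially"
    by (simp add: filterlim_at_top)
  have "eventually (\<lambda>n. \<forall>i\<in>{..<m}. dev n {R i..} \<le> exp (- (real n * (ln (R i) - s - \<eta>)))) sequentially"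
    by (rule eventually_ball_finite[OF finite_lessThan]) (rule ballI, rule dev_R)
  then show ?thesis using K0(2)[OF m] big eventually_ge_at_top[of 1]
  proof eventually_elim
    case (elim n)
    interpret P: prob_space "Q n" by (rule prob_space_Q[OF elim(4)])
    note [measurable] = Y_measurable[OF elim(4)]
    define g where "g y = ennreal (Rstar ^ n) + (\<Sum>i<m. ennreal (R (Suc i) ^ n) * indicator {y. y \<in> {R i..}} y)" for y
    have g_ge: "ennreal (y ^ n) \<le> g y" if y: "0 \<le> y" "y \<le> R m" for y
    proof -
      have nonneg: "0 \<le> R (Suc i) ^ n * indicator {R i..} y" for i
        using R_pos[of "Suc i"] by (simp add: less_imp_le)
      have "(\<Sum>i<m. ennreal (R (Suc i) ^ n) * indicator {y. y \<in> {R i..}} y) =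
          (\<Sum>i<m. ennreal (R (Suc i) ^ n * indicator {R i..} y))"
        by (intro sum.cong refl) (auto simp: indicator_def)
      also have "\<dots> = ennreal (\<Sum>i<m. R (Suc i) ^ n * indicator {R i..} y)"
        by (rule sum_ennreal) (rule nonneg)
      finally have "g y = ennreal (Rstar ^ n) + ennreal (\<Sum>i<m. R (Suc i) ^ n * indicator {R i..} y)"
        unfolding g_def by (rule arg_cong)
      also have "\<dots> = ennreal (Rstar ^ n + (\<Sum>i<m. R (Suc i) ^ n * indicator {R i..} y))"
        using Rstar_pos by (intro ennreal_plus[symmetric] sum_nonneg nonneg) simp
      finally have "g y = ennreal (Rstar ^ n + (\<Sum>i<m. R (Suc i) ^ n * indicator {R i..} y))" .
      then show ?thesis
        using power_le_grid_sum[OF \<eta> y(1), of m n] y(2) by (auto simp: R_def intro!: ennreal_leI)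
    qed
    have "moment n \<le> (\<integral>\<^sup>+\<omega>. g (Y n \<omega>) \<partial>Q n) + tail_moment n n (R m)"
    proof (rule moment_le_trunc_add_tail[OF elim(4) _ g_ge])
      show "g \<in> borel_measurable borel" unfolding g_def by measurable
    qed
    also have "(\<integral>\<^sup>+\<omega>. g (Y n \<omega>) \<partial>Q n) =
        ennreal (Rstar ^ n) + (\<Sum>i<m. \<integral>\<^sup>+\<omega>. ennreal (R (Suc i) ^ n) * indicator {\<omega>. Y n \<omega> \<in> {R i..}} \<omega> \<partial>Q n)"
    proof -
      have "(\<integral>\<^sup>+\<omega>. g (Y n \<omega>) \<partial>Q n) = (\<integral>\<^sup>+\<omega>. ennreal (Rstar ^ n) +
          (\<Sum>i<m. ennreal (R (Suc i) ^ n) * indicator {\<omega>. Y n \<omega> \<in> {R i..}} \<omega>) \<partial>Q n)"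
        by (auto simp: g_def indicator_def intro!: nn_integral_cong)
      also have "\<dots> = ennreal (Rstar ^ n) + (\<integral>\<^sup>+\<omega>. (\<Sum>i<m. ennreal (R (Suc i) ^ n) * indicator {\<omega>. Y n \<omega> \<in> {R i..}} \<omega>) \<partial>Q n)"
      proof -
        have "(\<lambda>\<omega>. \<Sum>i<m. ennreal (R (Suc i) ^ n) * indicator {\<omega>. Y n \<omega> \<in> {R i..}} \<omega>) \<in> borel_measurable (Q n)"
          by measurable
        then show ?thesis by (simp add: nn_integral_add P.emeasure_space_1 del: sum_mult_indicator)
      qed
      also have "(\<integral>\<^sup>+\<omega>. (\<Sum>i<m. ennreal (R (Suc i) ^ n) * indicator {\<omega>. Y n \<omega> \<in> {R i..}} \<omega>) \<partial>Q n) =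
          (\<Sum>i<m. \<integral>\<^sup>+\<omega>. ennreal (R (Suc i) ^ n) * indicator {\<omega>. Y n \<omega> \<in> {R i..}} \<omega> \<partial>Q n)"
        by (rule nn_integral_sum) auto
      finally show ?thesis .
    qed
    also have "\<dots> = ennreal (Rstar ^ n) + (\<Sum>i<m. ennreal (R (Suc i) ^ n) * ennreal (dev n {R i..}))"
      using elim(4) by (intro arg_cong2[where f="(+)"] sum.cong refl nn_integral_dev) auto
    also have "\<dots> \<le> ennreal (exp (n * (s + 2 * \<eta>))) + (\<Sum>i<m. ennreal (exp (n * (s + 2 * \<eta>))))"
    proof (intro add_mono sum_mono)
      have "Rstar ^ n = exp (n * ln Rstar)" using Rstar_pos by (simp add: exp_of_nat_mult)
      also have "\<dots> \<le> exp (n * (s + 2 * \<eta>))" using Rs \<eta> by (simp add: mult_left_mono)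
      finally show "ennreal (Rstar ^ n) \<le> ennreal (exp (n * (s + 2 * \<eta>)))" by (rule ennreal_leI)
      fix i assume i: "i \<in> {..<m}"
      have "R (Suc i) ^ n = exp (n * (ln (R i) + \<eta>))"
        using R_pos[of "Suc i"] by (simp add: exp_of_nat_mult ln_R[symmetric])
      moreover have "dev n {R i..} \<le> exp (- (real n * (ln (R i) - s - \<eta>)))"
        using elim(1) i by (rule bspec)
      ultimately have "R (Suc i) ^ n * dev n {R i..} \<le> exp (n * (ln (R i) + \<eta>)) * exp (- (real n * (ln (R i) - s - \<eta>)))"
        by (simp add: mult_left_mono)
      also have "\<dots> = exp (n * (s + 2 * \<eta>))" by (simp add: exp_add[symmetric] algebra_simps)
      finally show "ennreal (R (Suc i) ^ n) * ennreal (dev n {R i..}) \<le> ennreal (exp (n * (s + 2 * \<eta>)))"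
        using R_pos[of "Suc i"] by (subst ennreal_mult[symmetric]) (auto simp: dev_def intro!: ennreal_leI)
    qed
    also have "tail_moment n n (R m) \<le> ennreal (exp (n * (s + 2 * \<eta>)))"
    proof -
      have "tail_moment n n (R m) \<le> ennreal (exp s ^ n)" using elim(2) by simp
      also have "\<dots> \<le> ennreal (exp (n * (s + 2 * \<eta>)))"
        using \<eta> by (intro ennreal_leI) (simp add: exp_of_nat_mult[symmetric] mult_left_mono)
      finally show ?thesis .
    qed
    also have "ennreal (exp (n * (s + 2 * \<eta>))) + (\<Sum>i<m. ennreal (exp (n * (s + 2 * \<eta>)))) + ennreal (exp (n * (s + 2 * \<eta>)))
        = ennreal ((real m + 2) * exp (n * (s + 2 * \<eta>)))"
    proof -
      have "(\<Sum>i<m. ennreal (exp (n * (s + 2 * \<eta>)))) = ennreal (\<Sum>i<m. exp (n * (s + 2 * \<eta>)))"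
        by (rule sum_ennreal) simp
      also have "\<dots> = ennreal (real m * exp (n * (s + 2 * \<eta>)))" by simp
      finally show ?thesis
        by (simp only: distrib_right ennreal_plus[symmetric] exp_ge_zero mult_nonneg_nonneg of_nat_0_le_iff
            add_nonneg_nonneg mult_2 one_add_one[symmetric] mult_1) (simp add: algebra_simps)
    qed
    also have "\<dots> \<le> ennreal (exp (2 * \<eta> * n) * exp (n * (s + 2 * \<eta>)))"
      using elim(3) by (intro ennreal_leI mult_right_mono) auto
    also have "exp (2 * \<eta> * n) * exp (n * (s + 2 * \<eta>)) = exp (real n * e)"
    proof -
      have "e = s + 4 * \<eta>" by (simp add: \<eta>_def field_simps)
      then show ?thesis by (simp add: exp_add[symmetric] algebra_simps)
    qed
    finally show ?case by (simp add: add_mono)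
  qed
qed

text \<open>The first claim gives the second its meaning, since \<open>enn2real \<top>\<close> and
  \<open>ln 0\<close> are both 0 by default. For the lower bound, a near-minimiser
  \<open>R \<ge> Rstar\<close> is fed into \<open>moment_lower\<close>.\<close>

lemma moment_rate:
  assumes s: "ereal (- s) = (INF R\<in>{Rstar..}. I R - ereal (ln R))"
  shows "eventually (\<lambda>n. moment n < \<top> \<and> 0 < enn2real (moment n)) sequentially"
    and "(\<lambda>n. ln (enn2real (moment n)) / real n) \<longlonglongrightarrow> s"
proof -
  have upper: "eventually (\<lambda>n. moment n < \<top> \<and> enn2real (moment n) \<le> exp (real n * e)) sequentially" if "e > s" for e
    using moment_upper[OF s that]
    by eventually_elim (auto simp: enn2real_leI intro: le_less_trans)
  have lower: "eventually (\<lambda>n. exp (real n * d) \<le> enn2real (moment n)) sequentially" if d: "d < s" for d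
  proof -
    have "(INF R\<in>{Rstar..}. I R - ereal (ln R)) < ereal (- d)" using d by (simp add: s[symmetric])
    then obtain R where R: "R \<ge> Rstar" "I R - ereal (ln R) < ereal (- d)" by (auto simp: INF_less_iff)
    then have "I R < ereal (ln R - d)" using I_nonneg[of R] by (cases "I R") auto
    then obtain c where c: "I R < ereal c" "ereal c < ereal (ln R - d)" using ereal_dense2 by blast
    have "eventually (\<lambda>n. ennreal (exp (real n * d)) \<le> moment n) sequentially"
      using R(1) Rstar_pos c by (intro moment_lower[of R c]) auto
    then show ?thesis using upper[of "s + 1", simplified]
    proof eventually_elim
      case (elim n)
      then have "enn2real (ennreal (exp (real n * d))) \<le> enn2real (moment n)" by (intro enn2real_mono) auto
      then show ?case by simp
    qed
  qed
  show pos: "eventually (\<lambda>n. moment n < \<top> \<and> 0 < enn2real (moment n)) sequentially"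
    using upper[of "s + 1", simplified] lower[of "s - 1", simplified]
    by eventually_elim (auto intro: less_le_trans[OF exp_gt_zero])
  show "(\<lambda>n. ln (enn2real (moment n)) / real n) \<longlonglongrightarrow> s"
  proof (rule order_tendstoI)
    fix a assume "a < s"
    then obtain d where d: "a < d" "d < s" using dense by blast
    show "eventually (\<lambda>n. a < ln (enn2real (moment n)) / real n) sequentially"
      using lower[OF d(2)] pos eventually_ge_at_top[of 1]
    proof eventually_elim
      case (elim n)
      then have "n * d \<le> ln (enn2real (moment n))" by (metis exp_gt_zero ln_exp ln_le_cancel_iff)
      then have "d \<le> ln (enn2real (moment n)) / real n" using elim by (simp add: field_simps)
      then show ?case using d by simp
    qed
  next
    fix a assume "s < a"
    then obtain e where e: "s < e" "e < a" using dense by blast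
    show "eventually (\<lambda>n. ln (enn2real (moment n)) / real n < a) sequentially"
      using upper[OF e(1)] pos eventually_ge_at_top[of 1]
    proof eventually_elim
      case (elim n)
      then have "ln (enn2real (moment n)) \<le> n * e" by (metis exp_gt_zero ln_exp ln_le_cancel_iff)
      then have "ln (enn2real (moment n)) / real n \<le> e" using elim by (simp add: field_simps)
      then show ?case using e by simp
    qed
  qed
qed

end

section \<open>The volume fraction threshold\<close>

lemma one_minus_exp_bounds:
  fixes x :: real
  assumes "0 < x" "x \<le> 1"
  shows "x / 2 \<le> 1 - exp (- x)" "1 - exp (- x) \<le> x"
proof -
  have "exp (- x) \<le> inverse (1 + x)"
    unfolding exp_minus using exp_ge_add_one_self[of x] assms by (intro le_imp_inverse_le) auto
  \<comment> \<open>Equivalent to \<open>1 \<le> (1 + x) * (1 - x / 2)\<close>, that is, to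
    \<open>x\<^sup>2 \<le> x\<close>.\<close>
  also have "\<dots> \<le> 1 - x / 2" using assms by (simp add: field_simps power2_eq_square mult_left_le)
  finally show "x / 2 \<le> 1 - exp (- x)" by simp
  show "1 - exp (- x) \<le> x" using exp_ge_add_one_self[of "- x"] by simp
qed

text \<open>A negative rate drives \<open>l\<close> to 0, where \<open>1 - exp (- l)\<close> and
  \<open>l\<close> differ by a factor of at most 2; dividing \<open>ln 2\<close> by \<open>n\<close>
  removes it in the limit.\<close>

lemma subcritical_rate:
  fixes l :: "nat \<Rightarrow> real"
  assumes pos: "eventually (\<lambda>n. l n > 0) sequentially"
    and rate: "(\<lambda>n. ln (l n) / real n) \<longlonglongrightarrow> \<theta>" and \<theta>: "\<theta> < 0"
  shows "(\<lambda>n. 1 - exp (- l n)) \<longlonglongrightarrow> 0" "(\<lambda>n. ln (1 - exp (- l n)) / real n) \<longlonglongrightarrow> \<theta>"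
proof -
  have "filterlim (\<lambda>n. ln (l n) / real n * real n) at_bot sequentially"
    by (rule filterlim_tendsto_neg_mult_at_bot[OF rate \<theta> filterlim_real_sequentially])
  then have "(\<lambda>n. exp (ln (l n) / real n * real n)) \<longlonglongrightarrow> 0"
    by (rule filterlim_compose[OF exp_at_bot])
  moreover have "eventually (\<lambda>n. exp (ln (l n) / real n * real n) = l n) sequentially"
    using pos eventually_ge_at_top[of 1] by eventually_elim simp
  ultimately have l0: "l \<longlonglongrightarrow> 0" by (rule Lim_transform_eventually)
  then have "(\<lambda>n. 1 - exp (- l n)) \<longlonglongrightarrow> 1 - exp (- 0)" by (intro tendsto_intros)
  then show "(\<lambda>n. 1 - exp (- l n)) \<longlonglongrightarrow> 0" by simp
  have le1: "eventually (\<lambda>n. l n < 1) sequentially" using l0 by (rule order_tendstoD) simp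
  show "(\<lambda>n. ln (1 - exp (- l n)) / real n) \<longlonglongrightarrow> \<theta>"
  proof (rule tendsto_sandwich[OF _ _ _ rate])
    have "(\<lambda>n. ln (l n) / real n - ln 2 / real n) \<longlonglongrightarrow> \<theta> - 0"
      by (intro tendsto_intros rate lim_const_over_n)
    then show "(\<lambda>n. ln (l n) / real n - ln 2 / real n) \<longlonglongrightarrow> \<theta>" by simp
    show "eventually (\<lambda>n. ln (l n) / real n - ln 2 / real n \<le> ln (1 - exp (- l n)) / real n) sequentially"
      using pos le1
    proof eventually_elim
      case (elim n)
      have "ln (l n) - ln 2 = ln (l n / 2)" using elim by (simp add: ln_div)
      also have "\<dots> \<le> ln (1 - exp (- l n))" using one_minus_exp_bounds[of "l n"] elim by simp
      finally show ?case by (simp add: diff_divide_distrib[symmetric] divide_right_mono)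
    qed
    show "eventually (\<lambda>n. ln (1 - exp (- l n)) / real n \<le> ln (l n) / real n) sequentially"
      using pos le1
    proof eventually_elim
      case (elim n)
      then have "ln (1 - exp (- l n)) \<le> ln (l n)" using one_minus_exp_bounds[of "l n"] by simp
      then show ?case by (simp add: divide_right_mono)
    qed
  qed
qed

lemma supercritical_limit:
  fixes l :: "nat \<Rightarrow> real"
  assumes pos: "eventually (\<lambda>n. l n > 0) sequentially"
    and rate: "(\<lambda>n. ln (l n) / real n) \<longlonglongrightarrow> \<theta>" and \<theta>: "\<theta> > 0"
  shows "(\<lambda>n. 1 - exp (- l n)) \<longlonglongrightarrow> 1"
proof -
  have "filterlim (\<lambda>n. ln (l n) / real n * real n) at_top sequentially"
    by (rule filterlim_tendsto_pos_mult_at_top[OF rate \<theta> filterlim_real_sequentially])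
  then have "filterlim (\<lambda>n. exp (ln (l n) / real n * real n)) at_top sequentially"
    by (rule filterlim_compose[OF exp_at_top])
  moreover have "eventually (\<lambda>n. exp (ln (l n) / real n * real n) = l n) sequentially"
    using pos eventually_ge_at_top[of 1] by eventually_elim simp
  ultimately have "filterlim l at_top sequentially"
    by (subst (asm) filterlim_cong[OF refl refl]) auto
  then have "(\<lambda>n. exp (- l n)) \<longlonglongrightarrow> 0"
    by (intro filterlim_compose[OF exp_at_bot]) (simp add: filterlim_uminus_at_bot)
  then have "(\<lambda>n. 1 - exp (- l n)) \<longlonglongrightarrow> 1 - 0" by (intro tendsto_intros)
  then show ?thesis by simp
qed

text \<open>Here \<open>l n\<close> is the mean number of balls covering the origin, and its rate
  adds those of intensity, ball volume and moment. The formulas are claimed eventually: the model is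
  specified for \<open>n \<ge> 1\<close>, and the moment is known to be finite and positive only for
  large \<open>n\<close>.\<close>

lemma (in ldp_marks) boolean_model_intensity:
  assumes s: "ereal (- s) = (INF R\<in>{Rstar..}. I R - ereal (ln R))"
    and model: "boolean_model_sequence Q Y \<rho> r M T X"
  shows "\<exists>l. eventually (\<lambda>n. 0 < l n \<and> vacancy (M n) n (T n) (X n) = exp (- l n) \<and>
      volume_fraction (M n) n (T n) (X n) = 1 - exp (- l n)) sequentially \<and>
    (\<lambda>n. ln (l n) / real n) \<longlonglongrightarrow> \<rho> + 1/2 * ln (2 * pi * exp 1) + s"
proof -
  define a where "a n = unit_ball_vol (real n) * sqrt (real n) ^ n" for n
  define m where "m n = enn2real (moment n)" for n
  define l where "l n = exp (real n * r n) * (a n * m n)" for n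
  have r: "r \<longlonglongrightarrow> \<rho>" using model by (simp add: boolean_model_sequence_def)
  have a: "a n > 0" if "n \<ge> 1" for n using that by (simp add: a_def)
  have "eventually (\<lambda>n. 0 < l n \<and> vacancy (M n) n (T n) (X n) = exp (- l n) \<and>
      volume_fraction (M n) n (T n) (X n) = 1 - exp (- l n)) sequentially"
    using moment_rate(1)[OF s] eventually_ge_at_top[of 1]
  proof eventually_elim
    case (elim n)
    interpret iid_marked_poisson_process "M n" n "exp (real n * r n)" "T n" "distr (Q n) borel (Y n)" "X n"
      using model elim by (simp add: boolean_model_sequence_def)
    note [measurable] = Y_measurable[OF elim(2)]
    have "(\<integral>\<^sup>+t. ennreal (cover_prob t) \<partial>euclid n) =
        ennreal (a n) * (\<integral>\<^sup>+x. ennreal (x ^ n) \<partial>distr (Q n) borel (Y n))"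
      unfolding a_def using Y_nonneg[OF elim(2)]
      by (intro nn_integral_cover_prob elim(2)) (simp add: AE_distr_iff)
    also have "(\<integral>\<^sup>+x. ennreal (x ^ n) \<partial>distr (Q n) borel (Y n)) = moment n"
      unfolding moment_def by (rule nn_integral_distr) measurable
    also have "\<dots> = ennreal (m n)" using elim by (simp add: m_def)
    also have "ennreal (a n) * ennreal (m n) = ennreal (a n * m n)"
      using a[OF elim(2)] by (simp add: ennreal_mult m_def)
    finally have v: "(\<integral>\<^sup>+t. ennreal (cover_prob t) \<partial>euclid n) = ennreal (a n * m n)" .
    have "a n * m n > 0" using a elim by (simp add: m_def)
    then show ?case using vacancy_eq[OF v] by (simp add: l_def)
  qed
  moreover have "(\<lambda>n. ln (l n) / real n) \<longlonglongrightarrow> \<rho> + 1/2 * ln (2 * pi * exp 1) + s"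
  proof (rule Lim_transform_eventually)
    show "(\<lambda>n. r n + ln (a n) / real n + ln (m n) / real n) \<longlonglongrightarrow> \<rho> + 1/2 * ln (2 * pi * exp 1) + s"
      unfolding a_def m_def by (intro tendsto_add r ln_ball_volume_rate moment_rate(2)[OF s])
    show "eventually (\<lambda>n. r n + ln (a n) / real n + ln (m n) / real n = ln (l n) / real n) sequentially"
      using moment_rate(1)[OF s] eventually_ge_at_top[of 1]
    proof eventually_elim
      case (elim n)
      then have "ln (l n) = n * r n + (ln (a n) + ln (m n))"
        using a[OF elim(2)] by (simp add: l_def m_def ln_mult)
      then show ?case using elim by (simp add: add_divide_distrib)
    qed
  qed
  ultimately show ?thesis by blast
qed

lemma (in ldp_marks) boolean_model_limits:
  assumes s: "ereal (- s) = (INF R\<in>{Rstar..}. I R - ereal (ln R))"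
    and model: "boolean_model_sequence Q Y \<rho> r M T X"
    and \<tau>: "\<tau> = - (1/2 * ln (2 * pi * exp 1)) - s"
  shows "\<rho> < \<tau> \<Longrightarrow> (\<lambda>n. volume_fraction (M n) n (T n) (X n)) \<longlonglongrightarrow> 0"
    and "\<rho> < \<tau> \<Longrightarrow> (\<lambda>n. ext_ln (ereal (volume_fraction (M n) n (T n) (X n))) / ereal (real n)) \<longlonglongrightarrow> ereal (\<rho> - \<tau>)"
    and "\<rho> > \<tau> \<Longrightarrow> (\<lambda>n. volume_fraction (M n) n (T n) (X n)) \<longlonglongrightarrow> 1"
    and "\<rho> > \<tau> \<Longrightarrow> (\<lambda>n. ext_ln (- ext_ln (ereal (vacancy (M n) n (T n) (X n)))) / ereal (real n)) \<longlonglongrightarrow> ereal (\<rho> - \<tau>)"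
proof -
  obtain l where l: "eventually (\<lambda>n. 0 < l n \<and> vacancy (M n) n (T n) (X n) = exp (- l n) \<and>
      volume_fraction (M n) n (T n) (X n) = 1 - exp (- l n)) sequentially"
    and rate: "(\<lambda>n. ln (l n) / real n) \<longlonglongrightarrow> \<rho> + 1/2 * ln (2 * pi * exp 1) + s"
    using boolean_model_intensity[OF s model] by blast
  have rate: "(\<lambda>n. ln (l n) / real n) \<longlonglongrightarrow> \<rho> - \<tau>" using rate by (simp add: \<tau> algebra_simps)
  have pos: "eventually (\<lambda>n. 0 < l n) sequentially" using l by eventually_elim simp
  have vol: "eventually (\<lambda>n. 1 - exp (- l n) = volume_fraction (M n) n (T n) (X n)) sequentially"
    using l by eventually_elim simp
  {
    assume "\<rho> < \<tau>"
    then have neg: "\<rho> - \<tau> < 0" by simp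
    show "(\<lambda>n. volume_fraction (M n) n (T n) (X n)) \<longlonglongrightarrow> 0"
      using subcritical_rate(1)[OF pos rate neg] vol by (rule Lim_transform_eventually)
    have "(\<lambda>n. ereal (ln (1 - exp (- l n)) / real n)) \<longlonglongrightarrow> ereal (\<rho> - \<tau>)"
      using subcritical_rate(2)[OF pos rate neg] by simp
    then show "(\<lambda>n. ext_ln (ereal (volume_fraction (M n) n (T n) (X n))) / ereal (real n)) \<longlonglongrightarrow> ereal (\<rho> - \<tau>)"
    proof (rule Lim_transform_eventually)
      show "eventually (\<lambda>n. ereal (ln (1 - exp (- l n)) / real n) =
          ext_ln (ereal (volume_fraction (M n) n (T n) (X n))) / ereal (real n)) sequentially"
        using l eventually_ge_at_top[of 1] by eventually_elim (auto simp: ext_ln_def)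
    qed
  next
    assume "\<rho> > \<tau>"
    then have "\<rho> - \<tau> > 0" by simp
    from supercritical_limit[OF pos rate this] vol
    show "(\<lambda>n. volume_fraction (M n) n (T n) (X n)) \<longlonglongrightarrow> 1"
      by (rule Lim_transform_eventually)
    have "(\<lambda>n. ereal (ln (l n) / real n)) \<longlonglongrightarrow> ereal (\<rho> - \<tau>)" using rate by simp
    then show "(\<lambda>n. ext_ln (- ext_ln (ereal (vacancy (M n) n (T n) (X n)))) / ereal (real n)) \<longlonglongrightarrow> ereal (\<rho> - \<tau>)"
    proof (rule Lim_transform_eventually)
      show "eventually (\<lambda>n. ereal (ln (l n) / real n) =
          ext_ln (- ext_ln (ereal (vacancy (M n) n (T n) (X n)))) / ereal (real n)) sequentially"
        using l eventually_ge_at_top[of 1] by eventually_elim (auto simp: ext_ln_def)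
    qed
  }
qed

theorem theorem1:
  fixes Q :: "nat \<Rightarrow> 'b measure"
    and Xbar :: "nat \<Rightarrow> 'b \<Rightarrow> real"
    and I :: "real \<Rightarrow> ereal"
    and Rstar \<gamma> :: real
  assumes "\<And>n. n \<ge> 1 \<Longrightarrow> prob_space (Q n)"
    and "\<And>n. n \<ge> 1 \<Longrightarrow> Xbar n \<in> borel_measurable (Q n)"
    and "\<And>n. n \<ge> 1 \<Longrightarrow> AE \<omega> in Q n. 0 \<le> Xbar n \<omega>"
    and "0 < Rstar"
    and "(\<lambda>n. \<integral>\<^sup>+\<omega>. ennreal (Xbar n \<omega>) \<partial>Q n) \<longlonglongrightarrow> ennreal Rstar"
    and "good_rate_function I"
    and "convex_ereal I"
    and "large_deviations_principle Q Xbar I"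
    and "\<gamma> > 1"
    and "limsup (\<lambda>n. ennreal_powr (\<integral>\<^sup>+\<omega>. ennreal (Xbar n \<omega> powr (\<gamma> * real n)) \<partial>Q n) (1 / real n)) < \<infinity>"
  shows "\<exists>\<tau>::real.
    ereal \<tau> = - ereal (1/2 * ln (2 * pi * exp 1)) + (INF R\<in>{Rstar..}. I R - ereal (ln R)) \<and>
    (\<forall>(r :: real \<Rightarrow> nat \<Rightarrow> real) (M :: real \<Rightarrow> nat \<Rightarrow> 'a measure) T X.
       (\<forall>\<rho>. boolean_model_sequence Q Xbar \<rho> (r \<rho>) (M \<rho>) (T \<rho>) (X \<rho>)) \<longrightarrow>
       is_volume_fraction_threshold (\<lambda>\<rho> n. volume_fraction (M \<rho> n) n (T \<rho> n) (X \<rho> n)) \<tau>) \<and>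
    (\<forall>(\<rho>::real) r (M :: nat \<Rightarrow> 'a measure) T X.
       boolean_model_sequence Q Xbar \<rho> r M T X \<longrightarrow>
       (\<rho> < \<tau> \<longrightarrow>
          (\<lambda>n. volume_fraction (M n) n (T n) (X n)) \<longlonglongrightarrow> 0 \<and>
          (\<lambda>n. ext_ln (ereal (volume_fraction (M n) n (T n) (X n))) / ereal (real n))
            \<longlonglongrightarrow> ereal (\<rho> - \<tau>)) \<and>
       (\<rho> > \<tau> \<longrightarrow>
          (\<lambda>n. volume_fraction (M n) n (T n) (X n)) \<longlonglongrightarrow> 1 \<and>
          (\<lambda>n. ext_ln (- ext_ln (ereal (vacancy (M n) n (T n) (X n)))) / ereal (real n))
            \<longlonglongrightarrow> ereal (\<rho> - \<tau>)))"
proof -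
  interpret ldp_marks Q Xbar I Rstar \<gamma>
    by (rule ldp_marks.intro) (fact assms)+
  obtain s where s: "ereal (- s) = (INF R\<in>{Rstar..}. I R - ereal (ln R))"
    using INF_rate_finite ..
  define \<tau> where "\<tau> = - (1/2 * ln (2 * pi * exp 1)) - s"
  note limits = boolean_model_limits[OF s _ \<tau>_def]
  show ?thesis
  proof (intro exI[of _ \<tau>] conjI allI impI)
    show "ereal \<tau> = - ereal (1/2 * ln (2 * pi * exp 1)) + (INF R\<in>{Rstar..}. I R - ereal (ln R))"
      unfolding s[symmetric] \<tau>_def by simp
  next
    fix r :: "real \<Rightarrow> nat \<Rightarrow> real" and M :: "real \<Rightarrow> nat \<Rightarrow> 'a measure" and T X
    assume "\<forall>\<rho>. boolean_model_sequence Q Xbar \<rho> (r \<rho>) (M \<rho>) (T \<rho>) (X \<rho>)"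
    then show "is_volume_fraction_threshold (\<lambda>\<rho> n. volume_fraction (M \<rho> n) n (T \<rho> n) (X \<rho> n)) \<tau>"
      unfolding is_volume_fraction_threshold_def
      by (intro conjI allI impI; elim allE) (rule limits(1) limits(3); assumption)+
  qed (erule (1) limits)+
qed

end
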